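(* Let $d,p\in\mathbb{N}$, let $\mu_0(\mathrm{d}x)=\pi_0(x)\,\lambda_d(\mathrm{d}x)$ with $\pi_0\colon\mathbb{R}^d\to(0,\infty)$ infinitely often continuously differentiable, and let $\ell\colon\mathbb{R}^d\to[0,\infty)$ be measurable and satisfy the regularity conditions (M), (I), (T), (S), (P) listed in the context for this $p$, with associated manifolds $M_1,\dots,M_m$ and $\varepsilon>0$. Assume that $\dim M_i=k$ for all $i\in\{1,\dots,m\}$. For $n\in\mathbb{N}$ let $$\mu_n(\mathrm{d}x)=\frac1{Z_n}\exp(-n\ell(x))\,\mu_0(\mathrm{d}x),\qquad Z_n=\int_{\mathbb{R}^d}\exp(-n\ell(x))\,\mu_0(\mathrm{d}x).$$ Define $\phi\colon R_\ell\to[0,\infty)$ by $$\phi(u):=\frac{\sum_{i=1}^m\pi_0(S_i(0,u))\,\det\left(\frac{\partial^2(\ell\circ S_i)}{\partial^2t}(0,u)\right)^{-1/2}\mathbf{1}_{M_i}(u)}{\sum_{i=1}^m\int_{M_i}\pi_0(S_i(0,v))\,\det\left(\frac{\partial^2(\ell\circ S_i)}{\partial^2t}(0,v)\right)^{-1/2}\mathcal{M}_i(\mathrm{d}v)},$$ the measure $\mathcal{M}(\cdot):=\sum_{i=1}^m\mathcal{M}_i(\cdot\cap M_i)$ on $\mathcal{B}(R_\ell)$, and the probability measure $\mu(\mathrm{d}u):=\phi(u)\,\mathcal{M}(\mathrm{d}u)$ (regarded as a probability measure on $\mathbb{R}^d$). Assume moreover that $$\phi(u)-\sum_{i=1}^mZ_n^{-1}\,\zeta_i^{(n)}(u)\,\mathbf{1}_{M_i}(u)\ge0\qquad\text{for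 all }u\in R_\ell,\ n\in\mathbb{N},$$ where, for $u\in M_i$, $$\zeta_i^{(n)}(u)=\int_{B^{d-k}_\varepsilon(0)}\exp\big(-n\ell(S_i(t,u))\big)\,\pi_0(S_i(t,u))\,h_i(t,u)\,\lambda_{d-k}(\mathrm{d}t).$$ Then there is a constant $K\in(0,\infty)$ such that $$W^p(\mu_n,\mu)\le K\,n^{-1/2}\qquad\text{for all }n\in\mathbb{N}.$$
   Context: $\mathbb{N}=\{1,2,\dots\}$, $\lambda_s$ is Lebesgue measure on $\mathbb{R}^s$, $\|\cdot\|$ the Euclidean norm, $B^s_r(x)\subset\mathbb{R}^s$ the Euclidean ball of radius $r$ around $x$, $\mathbf{1}_A$ the indicator function of $A$. For probability measures $\mu,\nu$ on $\mathbb{R}^d$, $W^p(\mu,\nu)=\left(\inf_{\gamma}\int_{\mathbb{R}^{2d}}\|x-y\|^p\,\gamma(\mathrm{d}x,\mathrm{d}y)\right)^{1/p}$, the infimum being over all couplings $\gamma$ of $\mu$ and $\nu$. Admissible manifolds. A set $M\subset\mathbb{R}^d$ is called admissible (of dimension $k$) if it is a $k$-dimensional compact connected differentiable (smooth) orientable Riemannian manifold, endowed with the subspace topology, such that the inclusion $M\to\mathbb{R}^d$ is infinitely often continuously differentiable (so $M$ is a smooth embedded submanifold of $\mathbb{R}^d$ with the metric induced by the Euclidean one), and such that there are maps $v^{(1)},\dots,v^{(d-k)}$ on $M$, depending smoothly on $u\in M$, with $v^{(1)}(u),\dots,v^{(d-k)}(u)$ an orthonormal basis of the orthogonal complement $T_u(M)^\perp$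 of the tangent space $T_u(M)$ in $\mathbb{R}^d$ for all $u\in M$. The Riemannian volume measure on $M$ is called the intrinsic measure. For all sufficiently small $\varepsilon>0$ the map $(u,v)\mapsto u+v$ is a diffeomorphism from $\{(u,v):u\in M,\ v\in T_u(M)^\perp,\ \|v\|<\varepsilon\}$ onto an open neighbourhood $N(\varepsilon)\subseteq\mathbb{R}^d$ of $M$, the tubular neighbourhood; only such $\varepsilon$ are considered. Then $$S\colon B^{d-k}_\varepsilon(0)\times M\to N(\varepsilon),\quad (t_1,\dots,t_{d-k},u)\mapsto u+t_1v^{(1)}(u)+\dots+t_{d-k}v^{(d-k)}(u)$$ is a diffeomorphism. By a result of Weyl there are smooth functions $G_a^b(j)\colon M\to\mathbb{R}$ ($1\le j\le d-k$, $1\le a,b\le k$) such that, with $$h(t,u):=\det\Big[\Big(\delta_a^b+\sum_{j=1}^{d-k}t_j\,(G_a^b(j))(u)\Big)_{a,b\in\{1,\dots,k\}}\Big],$$ the measure on $B^{d-k}_\varepsilon(0)\times M$ with density $h$ with respect to the product of $\lambda_{d-k}$ and the intrinsic measure is pushed forward by $S$ to $\lambda_d|_{N(\varepsilon)}$; that is, $h\ge 0$ is the unique continuous function with $\int_{N(\varepsilon)}f\,\mathrm{d}\lambda_d=\int_M\int_{B^{d-k}_\varepsilon(0)}f(S(t,u))\,h(t,u)\,\lambda_{d-k}(\mathrm{d}t)\,\mathcal{M}(\mathrm{d}u)$ for all measurable $f\ge0$, where here $\mathcal{M}$ denotes the intrinsic measure of $M$. For admissible manifolds $M_1,\dots,M_m$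 these objects are indexed by $i$: dimension $k_i$, intrinsic measure $\mathcal{M}_i$, tubular neighbourhood $N_i(\varepsilon)$, diffeomorphism $S_i$, density $h_i$. $\frac{\partial^2(\ell\circ S_i)}{\partial^2t}(0,u)$ denotes the Hessian at $t=0$ of $t\mapsto(\ell\circ S_i)(t,u)$. Regularity conditions on $\ell$ (for given $p\in\mathbb{N}$): (M) For $R_\ell:=\{x\in\mathbb{R}^d:\ell(x)=0\}$ there exist $m\in\mathbb{N}$, $k_1,\dots,k_m\in\mathbb{N}$ and pairwise disjoint admissible manifolds $M_i$ of dimension $k_i$, $i=1,\dots,m$, with $R_\ell=\bigcup_{i=1}^mM_i$. (I) There exists $y_0\in R_\ell$ with $\int_{\mathbb{R}^d}\|x-y_0\|^p\exp(-\ell(x))\,\mu_0(\mathrm{d}x)<\infty$. (T) There exists $\varepsilon>0$ such that the tubular neighbourhoods $N_i(\varepsilon)$, $i=1,\dots,m$, are pairwise disjoint and for all $\delta\in(0,\varepsilon]$, $\inf\{\ell(x): x\in\mathbb{R}^d\setminus\bigcup_{i=1}^mN_i(\delta)\}>0$. (S) With this $\varepsilon$: on a set $F\subseteq\mathbb{R}^d$ the function $\ell$ is $(2p+2)$-times continuously differentiable (all partial derivatives up to order $2p+2$ exist and are continuous), and $N_i(\varepsilon)$ is contained in the interior of $F$ for all $i=1,\dots,m$. (P) For all $i=1,\dots,m$ and all $u\in M_i$ the Hessian $\frac{\partial^2(\ell\circ S_i)}{\partial^2t}(0,u)$ is positive definite. The $\varepsilon$ from (T), (S) is the one used in the definition of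 $\zeta_i^{(n)}$. *)

theory Defs
  imports "HOL-Analysis.Analysis"
begin

section \<open>Differentiability of higher order\<close>

definition partial_deriv ::
  "'a::real_normed_vector \<Rightarrow> ('a \<Rightarrow> 'b::real_normed_vector) \<Rightarrow> 'a \<Rightarrow> 'b" where
  "partial_deriv b f x = vector_derivative (\<lambda>s. f (x + s *\<^sub>R b)) (at 0)"

text \<open>All partial derivatives up to order \<open>n\<close> exist and are continuous. Only used for open sets,
  so that iterated partial derivatives depend only on the values of the function on the set.\<close>

primrec Ck_on :: "nat \<Rightarrow> ('a::euclidean_space \<Rightarrow> 'b::real_normed_vector) \<Rightarrow> 'a set \<Rightarrow> bool" where
  "Ck_on 0 f U \<longleftrightarrow> continuous_on U f"
| "Ck_on (Suc n) f U \<longleftrightarrow> continuous_on U f \<and>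
     (\<forall>b\<in>Basis. (\<forall>x\<in>U. (\<lambda>s. f (x + s *\<^sub>R b)) differentiable (at (0::real))) \<and>
        Ck_on n (partial_deriv b f) U)"

definition smooth_on_open :: "('a::euclidean_space \<Rightarrow> 'b::real_normed_vector) \<Rightarrow> 'a set \<Rightarrow> bool" where
  "smooth_on_open f U \<longleftrightarrow> open U \<and> (\<forall>n. Ck_on n f U)"

text \<open>Smoothness on an arbitrary subset of a Euclidean space, in particular on an embedded
  submanifold: locally the restriction of a smooth map defined on an open set.\<close>

definition smooth_map :: "('a::euclidean_space \<Rightarrow> 'b::real_normed_vector) \<Rightarrow> 'a set \<Rightarrow> bool" where
  "smooth_map f A \<longleftrightarrow>
     (\<forall>x\<in>A. \<exists>U F. x \<in> U \<and> smooth_on_open F U \<and> (\<forall>y\<in>U \<inter> A. F y = f y))"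

definition diffeomorphism ::
  "('a::euclidean_space \<Rightarrow> 'b::euclidean_space) \<Rightarrow> 'a set \<Rightarrow> 'b set \<Rightarrow> bool" where
  "diffeomorphism f A B \<longleftrightarrow> bij_betw f A B \<and> smooth_map f A \<and> smooth_map (inv_into A f) B"

definition hessian :: "(real^'n \<Rightarrow> real) \<Rightarrow> real^'n \<Rightarrow> real^'n^'n" where
  "hessian f x = (\<chi> a b. partial_deriv (axis a 1) (partial_deriv (axis b 1) f) x)"

definition pos_definite :: "real^'n^'n \<Rightarrow> bool" where
  "pos_definite A \<longleftrightarrow> (\<forall>x. x \<noteq> 0 \<longrightarrow> x \<bullet> (A *v x) > 0)"

section \<open>Admissible manifolds\<close>

text \<open>Conventions: the dimension \<open>k\<close> of a manifold is the cardinality of the index type \<open>'k\<close>, its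
  codimension \<open>d - k\<close> the cardinality of \<open>'c\<close>, and that of the ambient space the cardinality of
  \<open>'d\<close>. Since these types are nonempty, \<open>d - k = 0\<close> is not covered; it cannot occur, because a
  nonempty compact subset of \<open>\<real>\<^sup>d\<close> is not open.\<close>

definition local_parametrization :: "(real^'d) set \<Rightarrow> (real^'k) set \<Rightarrow> (real^'k \<Rightarrow> real^'d) \<Rightarrow> bool" where
  "local_parametrization M U \<psi> \<longleftrightarrow>
     smooth_on_open \<psi> U \<and>
     (\<forall>x\<in>U. inj (frechet_derivative \<psi> (at x))) \<and>
     openin (top_of_set M) (\<psi> ` U) \<and>
     (\<exists>\<psi>'. homeomorphism U (\<psi> ` U) \<psi> \<psi>')"

definition embedded_submanifold :: "'k::finite itself \<Rightarrow> (real^'d) set \<Rightarrow> bool" where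
  "embedded_submanifold K M \<longleftrightarrow>
     (\<forall>u\<in>M. \<exists>U (\<psi> :: real^'k \<Rightarrow> real^'d). local_parametrization M U \<psi> \<and> u \<in> \<psi> ` U)"

text \<open>Existence of an atlas all of whose transition maps have positive Jacobian determinant.\<close>

definition orientable :: "'k::finite itself \<Rightarrow> (real^'d) set \<Rightarrow> bool" where
  "orientable K M \<longleftrightarrow>
     (\<exists>\<A> :: ((real^'k) set \<times> (real^'k \<Rightarrow> real^'d)) set.
        (\<forall>(U, \<psi>)\<in>\<A>. local_parametrization M U \<psi>) \<and>
        M \<subseteq> (\<Union>(U, \<psi>)\<in>\<A>. \<psi> ` U) \<and>
        (\<forall>(U, \<psi>)\<in>\<A>. \<forall>(V, \<phi>)\<in>\<A>. \<forall>x\<in>U. \<psi> x \<in> \<phi> ` V \<longrightarrow>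
           det (matrix (frechet_derivative (inv_into V \<phi> \<circ> \<psi>) (at x))) > 0))"

text \<open>Velocities at \<open>u\<close> of smooth curves in \<open>M\<close>.\<close>

definition tangent_space :: "(real^'d) set \<Rightarrow> real^'d \<Rightarrow> (real^'d) set" where
  "tangent_space M u =
     {w. \<exists>c r. r > (0::real) \<and> smooth_on_open c {-r<..<r} \<and> c ` {-r<..<r} \<subseteq> M \<and>
           c 0 = u \<and> (c has_vector_derivative w) (at 0)}"

definition normal_frame :: "(real^'d) set \<Rightarrow> ('c::finite \<Rightarrow> real^'d \<Rightarrow> real^'d) \<Rightarrow> bool" where
  "normal_frame M v \<longleftrightarrow>
     (\<forall>j. smooth_map (v j) M) \<and>
     (\<forall>u\<in>M. (\<forall>i j. v i u \<bullet> v j u = (if i = j then 1 else 0)) \<and>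
             span (range (\<lambda>j. v j u)) = (tangent_space M u)\<^sup>\<bottom>)"

text \<open>The set \<open>M\<close> is admissible of dimension \<open>CARD('k)\<close>, with \<open>v\<close> the chosen normal frame.\<close>

definition admissible ::
  "'k::finite itself \<Rightarrow> (real^'d) set \<Rightarrow> ('c::finite \<Rightarrow> real^'d \<Rightarrow> real^'d) \<Rightarrow> bool" where
  "admissible K M v \<longleftrightarrow>
     embedded_submanifold K M \<and> compact M \<and> connected M \<and> orientable K M \<and> normal_frame M v"

text \<open>The Riemannian volume of the metric induced by the Euclidean one: in a local parametrization
  with Jacobian matrix \<open>J\<close>, its density is \<open>sqrt (det g)\<close> with Gram matrix \<open>g = J\<^sup>T J\<close>. As \<open>M\<close> is
  covered by countably many parametrized pieces, this determines the measure uniquely.\<close>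

definition riemannian_volume :: "'k::finite itself \<Rightarrow> (real^'d) set \<Rightarrow> (real^'d) measure \<Rightarrow> bool" where
  "riemannian_volume K M \<nu> \<longleftrightarrow>
     sets \<nu> = sets (restrict_space borel M) \<and>
     (\<forall>U (\<psi> :: real^'k \<Rightarrow> real^'d) B.
        local_parametrization M U \<psi> \<and> B \<in> sets borel \<and> B \<subseteq> U \<longrightarrow>
        emeasure \<nu> (\<psi> ` B) =
          (\<integral>\<^sup>+ x\<in>B. ennreal (sqrt (det (transpose (matrix (frechet_derivative \<psi> (at x))) **
                                      matrix (frechet_derivative \<psi> (at x))))) \<partial>lborel))"

section \<open>Tubular neighbourhoods\<close>

definition normal_bundle_ball :: "(real^'d) set \<Rightarrow> real \<Rightarrow> ((real^'d) \<times> (real^'d)) set" where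
  "normal_bundle_ball M \<epsilon> = {(u, w). u \<in> M \<and> w \<in> (tangent_space M u)\<^sup>\<bottom> \<and> norm w < \<epsilon>}"

definition tubular_nbhd :: "(real^'d) set \<Rightarrow> real \<Rightarrow> (real^'d) set" where
  "tubular_nbhd M \<epsilon> = (\<lambda>(u, w). u + w) ` normal_bundle_ball M \<epsilon>"

text \<open>The radii that are small enough for \<open>tubular_nbhd\<close> to be a tubular neighbourhood.\<close>

definition tubular_radius :: "(real^'d) set \<Rightarrow> real \<Rightarrow> bool" where
  "tubular_radius M \<epsilon> \<longleftrightarrow> \<epsilon> > 0 \<and> open (tubular_nbhd M \<epsilon>) \<and>
     diffeomorphism (\<lambda>(u, w). u + w) (normal_bundle_ball M \<epsilon>) (tubular_nbhd M \<epsilon>)"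

definition tube_map :: "('c::finite \<Rightarrow> real^'d \<Rightarrow> real^'d) \<Rightarrow> real^'c \<Rightarrow> real^'d \<Rightarrow> real^'d" where
  "tube_map v t u = u + (\<Sum>j\<in>UNIV. (t $ j) *\<^sub>R v j u)"

text \<open>Weyl's density \<open>h\<close>, built from coefficient functions \<open>G j a b\<close> on the manifold.\<close>

definition weyl_h ::
  "('c::finite \<Rightarrow> 'k::finite \<Rightarrow> 'k \<Rightarrow> real^'d \<Rightarrow> real) \<Rightarrow> real^'c \<Rightarrow> real^'d \<Rightarrow> real" where
  "weyl_h G t u =
     det ((\<chi> a b. (if a = b then 1 else 0) + (\<Sum>j\<in>UNIV. (t $ j) * G j a b u)) :: real^'k^'k)"

text \<open>Weyl's theorem provides, for every tubular radius, a family \<open>G\<close> with the following property.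
  The resulting density \<open>h\<close> on the ball times \<open>M\<close> does not depend on the choice of \<open>G\<close>, being the
  unique continuous nonnegative function that satisfies the integral formula.\<close>

definition weyl_coefficients ::
  "(real^'d) set \<Rightarrow> ('c::finite \<Rightarrow> real^'d \<Rightarrow> real^'d) \<Rightarrow> (real^'d) measure \<Rightarrow> real \<Rightarrow>
   ('c \<Rightarrow> 'k::finite \<Rightarrow> 'k \<Rightarrow> real^'d \<Rightarrow> real) \<Rightarrow> bool" where
  "weyl_coefficients M v \<nu> \<epsilon> G \<longleftrightarrow>
     (\<forall>j a b. smooth_map (G j a b) M) \<and>
     (\<forall>t\<in>ball 0 \<epsilon>. \<forall>u\<in>M. weyl_h G t u \<ge> 0) \<and>
     (\<forall>f \<in> borel_measurable borel.
        (\<integral>\<^sup>+ x\<in>tubular_nbhd M \<epsilon>. f x \<partial>lborel) =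
        (\<integral>\<^sup>+ u. (\<integral>\<^sup>+ t\<in>ball 0 \<epsilon>. f (tube_map v t u) * ennreal (weyl_h G t u) \<partial>lborel) \<partial>\<nu>))"

section \<open>Wasserstein distance\<close>

definition couplings ::
  "(real^'d) measure \<Rightarrow> (real^'d) measure \<Rightarrow> ((real^'d) \<times> (real^'d)) measure set" where
  "couplings \<mu> \<nu> = {\<gamma>. sets \<gamma> = sets borel \<and> distr \<gamma> borel fst = \<mu> \<and> distr \<gamma> borel snd = \<nu>}"

definition wasserstein :: "nat \<Rightarrow> (real^'d) measure \<Rightarrow> (real^'d) measure \<Rightarrow> ennreal" where
  "wasserstein p \<mu> \<nu> =
     (let c = (INF \<gamma>\<in>couplings \<mu> \<nu>. \<integral>\<^sup>+ (x, y). ennreal (norm (x - y) ^ p) \<partial>\<gamma>)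
      in if c = \<infinity> then \<infinity> else ennreal (root p (enn2real c)))"

section \<open>The Gibbs measures and their limit\<close>

definition prior :: "(real^'d \<Rightarrow> real) \<Rightarrow> (real^'d) measure" where
  "prior \<pi>0 = density lborel (\<lambda>x. ennreal (\<pi>0 x))"

definition normalization :: "(real^'d \<Rightarrow> real) \<Rightarrow> (real^'d \<Rightarrow> real) \<Rightarrow> nat \<Rightarrow> real" where
  "normalization \<pi>0 l n = (LINT x|prior \<pi>0. exp (- real n * l x))"

definition gibbs :: "(real^'d \<Rightarrow> real) \<Rightarrow> (real^'d \<Rightarrow> real) \<Rightarrow> nat \<Rightarrow> (real^'d) measure" where
  "gibbs \<pi>0 l n =
     density (prior \<pi>0) (\<lambda>x. ennreal (exp (- real n * l x) / normalization \<pi>0 l n))"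

definition zero_set :: "(real^'d \<Rightarrow> real) \<Rightarrow> (real^'d) set" where
  "zero_set l = {x. l x = 0}"

definition laplace_weight ::
  "(real^'d \<Rightarrow> real) \<Rightarrow> (real^'d \<Rightarrow> real) \<Rightarrow> ('c::finite \<Rightarrow> real^'d \<Rightarrow> real^'d) \<Rightarrow> real^'d \<Rightarrow> real" where
  "laplace_weight \<pi>0 l v u =
     \<pi>0 (tube_map v 0 u) * det (hessian (\<lambda>t. l (tube_map v t u)) 0) powr (-1/2)"

text \<open>The density \<open>\<phi>\<close>; the manifolds are indexed by \<open>1, \<dots>, m\<close>.\<close>

definition limit_density ::
  "(real^'d \<Rightarrow> real) \<Rightarrow> (real^'d \<Rightarrow> real) \<Rightarrow> nat \<Rightarrow> (nat \<Rightarrow> (real^'d) set) \<Rightarrow>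
   (nat \<Rightarrow> 'c::finite \<Rightarrow> real^'d \<Rightarrow> real^'d) \<Rightarrow> (nat \<Rightarrow> (real^'d) measure) \<Rightarrow> real^'d \<Rightarrow> real" where
  "limit_density \<pi>0 l m M v vol u =
     (\<Sum>i=1..m. laplace_weight \<pi>0 l (v i) u * indicator (M i) u) /
     (\<Sum>i=1..m. LINT w|vol i. laplace_weight \<pi>0 l (v i) w)"

definition total_volume ::
  "(real^'d \<Rightarrow> real) \<Rightarrow> nat \<Rightarrow> (nat \<Rightarrow> (real^'d) set) \<Rightarrow> (nat \<Rightarrow> (real^'d) measure) \<Rightarrow>
   (real^'d) measure" where
  "total_volume l m M vol =
     measure_of (zero_set l) (sets (restrict_space borel (zero_set l)))
       (\<lambda>A. \<Sum>i=1..m. emeasure (vol i) (A \<inter> M i))"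

text \<open>Pushed forward along the inclusion of \<open>zero_set l\<close> to be a measure on the whole space.\<close>

definition limit_measure ::
  "(real^'d \<Rightarrow> real) \<Rightarrow> (real^'d \<Rightarrow> real) \<Rightarrow> nat \<Rightarrow> (nat \<Rightarrow> (real^'d) set) \<Rightarrow>
   (nat \<Rightarrow> 'c::finite \<Rightarrow> real^'d \<Rightarrow> real^'d) \<Rightarrow> (nat \<Rightarrow> (real^'d) measure) \<Rightarrow> (real^'d) measure" where
  "limit_measure \<pi>0 l m M v vol =
     distr (density (total_volume l m M vol) (\<lambda>u. ennreal (limit_density \<pi>0 l m M v vol u)))
       borel (\<lambda>u. u)"

definition zeta ::
  "(real^'d \<Rightarrow> real) \<Rightarrow> (real^'d \<Rightarrow> real) \<Rightarrow> ('c::finite \<Rightarrow> real^'d \<Rightarrow> real^'d) \<Rightarrow>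
   ('c \<Rightarrow> 'k::finite \<Rightarrow> 'k \<Rightarrow> real^'d \<Rightarrow> real) \<Rightarrow> real \<Rightarrow> nat \<Rightarrow> real^'d \<Rightarrow> real" where
  "zeta \<pi>0 l v G \<epsilon> n u =
     (LINT t:ball 0 \<epsilon>|lborel.
        exp (- real n * l (tube_map v t u)) * \<pi>0 (tube_map v t u) * weyl_h G t u)"

end

(*
  By Weyl's formula, the part of the Gibbs measure in the tubular neighbourhoods is transported to the
  manifolds by the foot point projection P; the image has density zeta / Z_n with respect to the volume,
  and the domination hypothesis says exactly that it is bounded by the limit measure. So moving this part
  along P and coupling the remaining mass independently with what is missing of the limit measure is a
  coupling. Since l(S(t, u)) is bounded below by c |t|^2 on the tube, and above by C |t|^2 for small t,
  the first part costs at most const * n^(-(p + codim)/2) / Z_n with Z_n at least const * n^(-codim/2),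
  while outside the tubes l is bounded away from 0 and the cost is exponentially small. Asymptotics of Z_n
  beyond this crude bound are not needed.
*)

theory Submission
  imports Defs "HOL-Probability.Probability_Measure"
begin

section \<open>First and second directional derivatives\<close>

text \<open>The obstacle is uniformity. Condition (P) speaks of t = 0 and of each u separately, but
  one constant c must satisfy l(S(t, u)) >= c |t|^2 on the whole tube. Write a normal vector as s
  times a unit vector: the second derivative of l along normal lines is then a continuous function
  of s and of a point of a compact set, the unit normal directions over M. It is positive at s = 0,
  hence bounded below for all small s, and condition (T) takes over for the larger ones. Since
  smoothness is given through iterated partial derivatives, the total derivative, the derivatives
  along lines and the link between the Hessian in t and the ambient derivatives of l have to be
  built from those. The rate comes from scaling t by n^(-1/2): the cost in the tubes and Z_n both
  contain the volume n^(-codim/2) of a normal ball of that radius, which cancels in the quotient;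
  what is left is n^(-p/2), whose p-th root is n^(-1/2). All bounds are proved for every n >= 1 at
  once, so that no finite set of small n remains to be absorbed into the constant.\<close>

lemma has_real_derivative_partial_deriv:
  fixes f :: "'a::real_normed_vector \<Rightarrow> real"
  assumes "(\<lambda>r. f ((y + s *\<^sub>R b) + r *\<^sub>R b)) differentiable (at 0)"
  shows "((\<lambda>r. f (y + r *\<^sub>R b)) has_real_derivative partial_deriv b f (y + s *\<^sub>R b)) (at s)"
proof -
  have "((\<lambda>r. f ((y + s *\<^sub>R b) + r *\<^sub>R b)) has_real_derivative partial_deriv b f (y + s *\<^sub>R b)) (at 0)"
    using assms unfolding partial_deriv_def
    by (simp add: has_real_derivative_iff_has_vector_derivative vector_derivative_works)
  then have "((\<lambda>r. f (y + (r + s) *\<^sub>R b)) has_real_derivative partial_deriv b f (y + s *\<^sub>R b)) (at 0)"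
    by (simp add: algebra_simps)
  then show ?thesis
    using DERIV_shift[of "\<lambda>r. f (y + r *\<^sub>R b)" "partial_deriv b f (y + s *\<^sub>R b)" 0 s] by simp
qed

definition dir1 :: "('a::euclidean_space \<Rightarrow> real) \<Rightarrow> 'a \<Rightarrow> 'a \<Rightarrow> real" where
  "dir1 f x w = (\<Sum>b\<in>Basis. (w \<bullet> b) * partial_deriv b f x)"

text \<open>The second differential as a bilinear form, written with partial derivatives because
  these are what \<open>Ck_on\<close> provides. The derivative along \<open>w\<close> is taken
  first, which matches the nesting in \<open>hessian\<close>.\<close>

definition dir2 :: "('a::euclidean_space \<Rightarrow> real) \<Rightarrow> 'a \<Rightarrow> 'a \<Rightarrow> 'a \<Rightarrow> real" where
  "dir2 f x w w' = (\<Sum>b\<in>Basis. (w \<bullet> b) * dir1 (partial_deriv b f) x w')"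

lemma Ck_on_mono: "Ck_on n f U \<Longrightarrow> k \<le> n \<Longrightarrow> Ck_on k f U"
proof (induction n arbitrary: k f)
  case (Suc n)
  then show ?case by (cases k) auto
qed auto

text \<open>The increment is made one coordinate at a time, by induction on the set \<open>B\<close>
  of coordinates already changed, with the mean value theorem on each axis-parallel segment. The
  bound \<open>d\<close> on the l1 norm of the increment keeps all these segments inside the
  ball.\<close>

lemma partials_bound:
  fixes f :: "'a::euclidean_space \<Rightarrow> real"
  assumes "finite B" "B \<subseteq> Basis"
    and d: "\<And>b y. b \<in> Basis \<Longrightarrow> y \<in> ball x d \<Longrightarrow> (\<lambda>s. f (y + s *\<^sub>R b)) differentiable (at 0)"
    and e: "\<And>b y. b \<in> Basis \<Longrightarrow> y \<in> ball x d \<Longrightarrow> \<bar>partial_deriv b f y - partial_deriv b f x\<bar> \<le> e"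
    and c: "(\<Sum>b\<in>B. \<bar>c b\<bar>) < d"
  shows "\<bar>f (x + (\<Sum>b\<in>B. c b *\<^sub>R b)) - f x - (\<Sum>b\<in>B. c b * partial_deriv b f x)\<bar> \<le> e * (\<Sum>b\<in>B. \<bar>c b\<bar>)"
  using assms(1,2) c
proof (induction B rule: finite_induct)
  case (insert a B)
  define y where "y = x + (\<Sum>b\<in>B. c b *\<^sub>R b)"
  have a: "a \<in> Basis" "norm a = 1" using insert by auto
  have B: "norm (\<Sum>b\<in>B. c b *\<^sub>R b) \<le> (\<Sum>b\<in>B. \<bar>c b\<bar>)"
    by (rule sum_norm_le) (use insert in auto)
  have inb: "y + s *\<^sub>R a \<in> ball x d" if "\<bar>s\<bar> \<le> \<bar>c a\<bar>" for s
  proof -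
    have "norm ((\<Sum>b\<in>B. c b *\<^sub>R b) + s *\<^sub>R a) \<le> (\<Sum>b\<in>B. \<bar>c b\<bar>) + \<bar>c a\<bar>"
      using norm_triangle_ineq[of "\<Sum>b\<in>B. c b *\<^sub>R b" "s *\<^sub>R a"] B a that by simp
    also have "\<dots> < d" using insert by simp
    finally have "norm ((\<Sum>b\<in>B. c b *\<^sub>R b) + s *\<^sub>R a) < d" .
    moreover have "dist x (y + s *\<^sub>R a) = norm ((\<Sum>b\<in>B. c b *\<^sub>R b) + s *\<^sub>R a)"
      unfolding y_def by (subst dist_commute) (simp add: dist_norm)
    ultimately show ?thesis by simp
  qed
  \<comment> \<open>Subtracting the linear term leaves a function whose derivative is the
    oscillation of the partial derivative, hence at most \<open>e\<close>.\<close>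
  have "norm ((f (y + c a *\<^sub>R a) - c a * partial_deriv a f x) - (f (y + 0 *\<^sub>R a) - 0 * partial_deriv a f x))
      \<le> e * norm (c a - 0)"
  proof (rule field_differentiable_bound[of "closed_segment 0 (c a)"
      "\<lambda>s. f (y + s *\<^sub>R a) - s * partial_deriv a f x" "\<lambda>s. partial_deriv a f (y + s *\<^sub>R a) - partial_deriv a f x"])
    fix z assume "z \<in> closed_segment 0 (c a)"
    then have z: "\<bar>z\<bar> \<le> \<bar>c a\<bar>" by (auto simp: closed_segment_eq_real_ivl split: if_splits)
    have "((\<lambda>r. f (y + r *\<^sub>R a)) has_real_derivative partial_deriv a f (y + z *\<^sub>R a)) (at z)"
      by (rule has_real_derivative_partial_deriv) (use d a inb z in blast)
    then show "((\<lambda>s. f (y + s *\<^sub>R a) - s * partial_deriv a f x) has_field_derivative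
        partial_deriv a f (y + z *\<^sub>R a) - partial_deriv a f x) (at z within closed_segment 0 (c a))"
      by (auto intro!: derivative_eq_intros intro: has_field_derivative_at_within)
    show "norm (partial_deriv a f (y + z *\<^sub>R a) - partial_deriv a f x) \<le> e"
      using e a inb z by simp
  qed auto
  moreover have "\<bar>f y - f x - (\<Sum>b\<in>B. c b * partial_deriv b f x)\<bar> \<le> e * (\<Sum>b\<in>B. \<bar>c b\<bar>)"
    unfolding y_def by (rule insert.IH) (use insert in auto)
  moreover have "x + (\<Sum>b\<in>insert a B. c b *\<^sub>R b) = y + c a *\<^sub>R a"
    "(\<Sum>b\<in>insert a B. c b * partial_deriv b f x) = c a * partial_deriv a f x + (\<Sum>b\<in>B. c b * partial_deriv b f x)"
    "e * (\<Sum>b\<in>insert a B. \<bar>c b\<bar>) = e * \<bar>c a\<bar> + e * (\<Sum>b\<in>B. \<bar>c b\<bar>)"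
    using insert by (auto simp: y_def algebra_simps)
  ultimately show ?case by simp
qed auto

text \<open>Near \<open>x\<close> all partial derivatives oscillate by at most \<open>e / N\<close>;
  the dimension \<open>N\<close> pays for the passage from the l1 norm of the increment to its
  Euclidean norm.\<close>

lemma has_derivative_dir1:
  fixes f :: "'a::euclidean_space \<Rightarrow> real"
  assumes U: "open U" "x \<in> U" and C: "Ck_on 1 f U"
  shows "(f has_derivative dir1 f x) (at x)"
  unfolding has_derivative_at_alt
proof safe
  show "bounded_linear (dir1 f x)"
    unfolding dir1_def by (auto intro!: bounded_linear_intros)
  fix e :: real assume e: "e > 0"
  define N where "N = real DIM('a)"
  have N: "N > 0" by (simp add: N_def)
  have "\<forall>b\<in>Basis. \<exists>d>0. \<forall>y. dist y x < d \<longrightarrow> \<bar>partial_deriv b f y - partial_deriv b f x\<bar> < e / N"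
  proof
    fix b :: 'a assume "b \<in> Basis"
    then have "continuous (at x) (partial_deriv b f)"
      using C U by (simp add: continuous_on_eq_continuous_at)
    then show "\<exists>d>0. \<forall>y. dist y x < d \<longrightarrow> \<bar>partial_deriv b f y - partial_deriv b f x\<bar> < e / N"
      unfolding continuous_at_eps_delta using e N by (auto simp: dist_real_def)
  qed
  then obtain D where D: "\<And>b. b \<in> Basis \<Longrightarrow> D b > 0 \<and> (\<forall>y. dist y x < D b \<longrightarrow> \<bar>partial_deriv b f y - partial_deriv b f x\<bar> < e / N)"
    by metis
  obtain r where r: "r > 0" "ball x r \<subseteq> U" using U openE by blast
  define d where "d = Min (insert r (D ` Basis))"
  have d0: "d > 0" unfolding d_def using r D by auto
  have dr: "d \<le> r" and dD: "\<And>b. b \<in> Basis \<Longrightarrow> d \<le> D b" unfolding d_def by (auto intro: Min_le simp del: Min_insert)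
  have "norm (f y - f x - dir1 f x (y - x)) \<le> e * norm (y - x)" if y: "norm (y - x) < d / N" for y
  proof -
    let ?c = "\<lambda>b. (y - x) \<bullet> b"
    have s: "(\<Sum>b\<in>Basis. \<bar>?c b\<bar>) \<le> N * norm (y - x)"
      using sum_bounded_above[of Basis "\<lambda>b. \<bar>?c b\<bar>" "norm (y - x)"] by (simp add: N_def Basis_le_norm)
    also have "\<dots> < d" using y N by (simp add: field_simps)
    finally have lt: "(\<Sum>b\<in>Basis. \<bar>?c b\<bar>) < d" .
    have "\<bar>f (x + (\<Sum>b\<in>Basis. ?c b *\<^sub>R b)) - f x - (\<Sum>b\<in>Basis. ?c b * partial_deriv b f x)\<bar>
        \<le> e / N * (\<Sum>b\<in>Basis. \<bar>?c b\<bar>)"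
    proof (rule partials_bound[where d = d])
      fix b y :: 'a assume b: "b \<in> Basis" and y: "y \<in> ball x d"
      then have "y \<in> U" using r dr by auto
      then show "(\<lambda>s. f (y + s *\<^sub>R b)) differentiable at 0" using C b by auto
      show "\<bar>partial_deriv b f y - partial_deriv b f x\<bar> \<le> e / N"
        using D[OF b] dD[OF b] y by (auto simp: dist_commute intro!: less_imp_le)
    qed (use lt in auto)
    also have "\<dots> \<le> e / N * (N * norm (y - x))" using s e N by (intro mult_left_mono) auto
    finally show ?thesis using N by (simp add: euclidean_representation dir1_def)
  qed
  then show "\<exists>d>0. \<forall>y. norm (y - x) < d \<longrightarrow> norm (f y - f x - dir1 f x (y - x)) \<le> e * norm (y - x)"
    using d0 N by (intro exI[of _ "d / N"]) auto
qed

lemma has_real_derivative_line: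
  fixes f :: "'a::euclidean_space \<Rightarrow> real"
  assumes "open U" "Ck_on 1 f U" "x + s *\<^sub>R w \<in> U"
  shows "((\<lambda>s. f (x + s *\<^sub>R w)) has_real_derivative dir1 f (x + s *\<^sub>R w) w) (at s)"
proof -
  have "((\<lambda>s. x + s *\<^sub>R w) has_derivative (\<lambda>r. r *\<^sub>R w)) (at s)"
    by (auto intro!: derivative_eq_intros)
  from has_derivative_compose[OF this has_derivative_dir1[OF assms(1,3,2)]]
  have "((\<lambda>s. f (x + s *\<^sub>R w)) has_derivative (\<lambda>r. dir1 f (x + s *\<^sub>R w) (r *\<^sub>R w))) (at s)" .
  moreover have "(\<lambda>r. dir1 f (x + s *\<^sub>R w) (r *\<^sub>R w)) = (*) (dir1 f (x + s *\<^sub>R w) w)"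
    by (auto simp: dir1_def fun_eq_iff sum_distrib_left sum_distrib_right mult_ac)
  ultimately show ?thesis by (simp add: has_field_derivative_def)
qed

lemma has_real_derivative_line2:
  fixes f :: "'a::euclidean_space \<Rightarrow> real"
  assumes "open U" "Ck_on 2 f U" "x + s *\<^sub>R w \<in> U"
  shows "((\<lambda>s. dir1 f (x + s *\<^sub>R w) w') has_real_derivative dir2 f (x + s *\<^sub>R w) w' w) (at s)"
proof -
  have "((\<lambda>s. partial_deriv b f (x + s *\<^sub>R w)) has_real_derivative dir1 (partial_deriv b f) (x + s *\<^sub>R w) w) (at s)"
    if "b \<in> Basis" for b
  proof (rule has_real_derivative_line[OF assms(1) _ assms(3)])
    show "Ck_on 1 (partial_deriv b f) U" using assms(2) that by (auto simp: numeral_2_eq_2)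
  qed
  then show ?thesis unfolding dir1_def[of f] dir2_def
    by (intro DERIV_sum DERIV_cmult) auto
qed

text \<open>An affine map has no second derivative, so the chain rule leaves only second derivatives
  of \<open>f\<close> in the directions \<open>w\<close>. This moves the Hessian of condition (P)
  into the ambient space, where continuity in \<open>u\<close> is available.\<close>

lemma hessian_affine:
  fixes f :: "'a::euclidean_space \<Rightarrow> real" and w :: "'c::finite \<Rightarrow> 'a"
  assumes U: "open U" "Ck_on 2 f U" and "\<epsilon> > 0"
    and sub: "\<And>t. t \<in> ball 0 \<epsilon> \<Longrightarrow> u + (\<Sum>j\<in>UNIV. (t $ j) *\<^sub>R w j) \<in> U"
  shows "hessian (\<lambda>t. f (u + (\<Sum>j\<in>UNIV. (t $ j) *\<^sub>R w j))) 0 = (\<chi> a b. dir2 f u (w b) (w a))"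
proof -
  let ?g = "\<lambda>t. f (u + (\<Sum>j\<in>UNIV. (t $ j) *\<^sub>R w j))"
  have ax: "u + (\<Sum>j\<in>UNIV. ((t + s *\<^sub>R axis b 1) $ j) *\<^sub>R w j) = (u + (\<Sum>j\<in>UNIV. (t $ j) *\<^sub>R w j)) + s *\<^sub>R w b"
    for t :: "real^'c" and s b
  proof -
    have "(\<Sum>j\<in>UNIV. ((t + s *\<^sub>R axis b 1) $ j) *\<^sub>R w j) =
        (\<Sum>j\<in>UNIV. (t $ j) *\<^sub>R w j) + (\<Sum>j\<in>UNIV. if j = b then s *\<^sub>R w j else 0)"
      unfolding sum.distrib[symmetric] by (rule sum.cong) (auto simp: axis_def algebra_simps)
    then show ?thesis by simp
  qed
  have 1: "partial_deriv (axis b 1) ?g t = dir1 f (u + (\<Sum>j\<in>UNIV. (t $ j) *\<^sub>R w j)) (w b)" if "t \<in> ball 0 \<epsilon>" for t b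
    unfolding partial_deriv_def[where f = ?g] ax
    using has_real_derivative_line[OF U(1) Ck_on_mono[OF U(2), of 1], of "u + (\<Sum>j\<in>UNIV. (t $ j) *\<^sub>R w j)" 0 "w b"] sub[OF that]
    by (intro vector_derivative_at) (simp add: has_real_derivative_iff_has_vector_derivative)
  have "partial_deriv (axis a 1) (partial_deriv (axis b 1) ?g) 0 = dir2 f u (w b) (w a)" for a b
  proof -
    have u: "u \<in> U" using sub[of 0] \<open>\<epsilon> > 0\<close> by simp
    have "((\<lambda>s. dir1 f (u + s *\<^sub>R w a) (w b)) has_vector_derivative dir2 f u (w b) (w a)) (at 0)"
      using has_real_derivative_line2[OF U, of u 0 "w a" "w b"] u
      by (simp add: has_real_derivative_iff_has_vector_derivative)
    \<comment> \<open>The formula for the inner derivative is known on the ball only; a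
      neighbourhood of \<open>s = 0\<close> suffices for the outer derivative.\<close>
    moreover have "\<forall>\<^sub>F s in nhds 0. partial_deriv (axis b 1) ?g (0 + s *\<^sub>R axis a 1) = dir1 f (u + s *\<^sub>R w a) (w b)"
    proof -
      have "\<forall>\<^sub>F s::real in nhds 0. s \<in> ball 0 \<epsilon>"
        using \<open>\<epsilon> > 0\<close> by (intro eventually_nhds_in_open) auto
      then show ?thesis
      proof eventually_elim
        case (elim s)
        have "partial_deriv (axis b 1) ?g (0 + s *\<^sub>R axis a 1) = 
           dir1 f (u + (\<Sum>j\<in>UNIV. ((0 + s *\<^sub>R axis a 1) $ j) *\<^sub>R w j)) (w b)"
          by (rule 1) (use elim in auto)
        then show ?case unfolding ax by simp
      qed
    qed
    ultimately have "((\<lambda>s. partial_deriv (axis b 1) ?g (0 + s *\<^sub>R axis a 1)) has_vector_derivative dir2 f u (w b) (w a)) (at 0)"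
      by (subst has_vector_derivative_cong_ev[where g = "\<lambda>s. dir1 f (u + s *\<^sub>R w a) (w b)"])
        (auto elim!: eventually_mono dest: eventually_nhds_x_imp_x)
    then show ?thesis unfolding partial_deriv_def[of "axis a 1"] by (rule vector_derivative_at)
  qed
  then show ?thesis by (simp add: hessian_def vec_eq_iff)
qed

lemma quadratic_form_affine:
  fixes w :: "'c::finite \<Rightarrow> 'a::euclidean_space" and \<theta> :: "real^'c"
  shows "\<theta> \<bullet> ((\<chi> a b. dir2 f u (w b) (w a)) *v \<theta>) =
    dir2 f u (\<Sum>j\<in>UNIV. (\<theta> $ j) *\<^sub>R w j) (\<Sum>j\<in>UNIV. (\<theta> $ j) *\<^sub>R w j)"
proof -
  have l: "linear (\<lambda>w. dir2 f u w w')" "linear (\<lambda>w'. dir2 f u w w')" for w w'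
    by (rule linearI; simp add: dir2_def dir1_def inner_add_left algebra_simps sum.distrib sum_distrib_left)+
  let ?W = "\<Sum>j\<in>UNIV. (\<theta> $ j) *\<^sub>R w j"
  have "dir2 f u ?W ?W = (\<Sum>a\<in>UNIV. (\<theta> $ a) * (\<Sum>b\<in>UNIV. (\<theta> $ b) * dir2 f u (w b) (w a)))"
    by (subst linear_sum[OF l(2)], subst linear_sum[OF l(1)])
      (simp add: linear_scale[OF l(2)] linear_scale[OF l(1)] sum_distrib_left mult_ac)
  then show ?thesis by (simp add: inner_vec_def matrix_vector_mult_def mult_ac)
qed

text \<open>Along the line, \<open>f\<close> is nonnegative and vanishes at \<open>x\<close>, so the
  first derivative is zero there and the second order Lagrange remainder is the whole value.\<close>

lemma taylor2_bounds:
  fixes f :: "'a::euclidean_space \<Rightarrow> real"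
  assumes U: "open U" "Ck_on 2 f U"
    and nonneg: "\<And>y. f y \<ge> 0" and "f x = 0" and s: "0 \<le> s"
    and sub: "\<And>r. \<bar>r\<bar> \<le> s \<Longrightarrow> x + r *\<^sub>R w \<in> U"
    and bd: "\<And>r. \<bar>r\<bar> \<le> s \<Longrightarrow> c \<le> dir2 f (x + r *\<^sub>R w) w w \<and> dir2 f (x + r *\<^sub>R w) w w \<le> C"
  shows "c * s\<^sup>2 / 2 \<le> f (x + s *\<^sub>R w)" "f (x + s *\<^sub>R w) \<le> C * s\<^sup>2 / 2"
proof -
  have "c * s\<^sup>2 / 2 \<le> f (x + s *\<^sub>R w) \<and> f (x + s *\<^sub>R w) \<le> C * s\<^sup>2 / 2"
  proof (cases "s = 0")
    case False
    then have s: "s > 0" using s by simp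
    \<comment> \<open>Derivatives of order 0, 1, 2 along the line, in the indexed form that
      \<open>Maclaurin\<close> expects.\<close>
    define g where "g m r = (if m = 0 then f (x + r *\<^sub>R w) else if m = 1 then dir1 f (x + r *\<^sub>R w) w
        else dir2 f (x + r *\<^sub>R w) w w)" for m :: nat and r
    have "\<forall>m t. m < 2 \<and> 0 \<le> t \<and> t \<le> s \<longrightarrow> DERIV (g m) t :> g (Suc m) t"
    proof safe
      fix m :: nat and t assume "m < 2" "0 \<le> t" "t \<le> s"
      then have "m = 0 \<or> m = 1" "x + t *\<^sub>R w \<in> U" using sub[of t] by auto
      then show "DERIV (g m) t :> g (Suc m) t"
        using has_real_derivative_line[OF U(1) Ck_on_mono[OF U(2), of 1], of x t w]
          has_real_derivative_line2[OF U, of x t w w]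
        by (auto simp: g_def[abs_def])
    qed
    then obtain t where t: "0 < t" "t < s" and
      eq: "f (x + s *\<^sub>R w) = (\<Sum>m<2. (g m 0 / fact m) * s ^ m) + (g 2 t / fact 2) * s ^ 2"
      using Maclaurin[of s 2 g "\<lambda>r. f (x + r *\<^sub>R w)"] s by (auto simp: g_def[of 0] fun_eq_iff)
    have "dir1 f (x + 0 *\<^sub>R w) w = 0"
      by (rule DERIV_local_min[of "\<lambda>r. f (x + r *\<^sub>R w)" _ _ s])
        (use s sub[of 0] nonneg \<open>f x = 0\<close> has_real_derivative_line[OF U(1) Ck_on_mono[OF U(2), of 1], of x 0 w] in auto)
    then have "f (x + s *\<^sub>R w) = dir2 f (x + t *\<^sub>R w) w w * s\<^sup>2 / 2"
      using eq \<open>f x = 0\<close> by (simp add: g_def numeral_2_eq_2)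
    then show ?thesis using bd[of t] t by (auto intro!: mult_right_mono)
  qed (use \<open>f x = 0\<close> in auto)
  then show "c * s\<^sup>2 / 2 \<le> f (x + s *\<^sub>R w)" "f (x + s *\<^sub>R w) \<le> C * s\<^sup>2 / 2" by auto
qed

lemma continuous_on_dir2:
  fixes f :: "'a::euclidean_space \<Rightarrow> real"
  assumes "Ck_on 2 f U" "continuous_on T x" "x ` T \<subseteq> U" "continuous_on T w" "continuous_on T w'"
  shows "continuous_on T (\<lambda>t. dir2 f (x t) (w t) (w' t))"
proof -
  have "continuous_on U (partial_deriv b' (partial_deriv b f))" if "b \<in> Basis" "b' \<in> Basis" for b b'
    using assms(1) that by (auto simp: numeral_2_eq_2)
  from continuous_on_compose2[OF this assms(2,3)] show ?thesis
    unfolding dir2_def dir1_def by (auto intro!: continuous_intros assms)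
qed

section \<open>A coupling adapted to a projection\<close>

text \<open>Points of \<open>N\<close> move along \<open>P\<close>; the others are coupled independently with the normalized
  difference \<open>\<rho>\<close> of \<open>\<nu>\<close> and the image of the restriction of \<open>\<mu>\<close> to \<open>N\<close>.\<close>

lemma ex_coupling_projection:
  fixes \<mu> \<nu> :: "(real^'d) measure"
  assumes \<mu>: "prob_space \<mu>" "sets \<mu> = sets borel" and \<nu>: "prob_space \<nu>" "sets \<nu> = sets borel"
    and [measurable]: "N \<in> sets borel" "P \<in> borel_measurable borel" "Z \<in> sets borel"
    and dom: "\<And>A. A \<in> sets borel \<Longrightarrow> emeasure \<mu> {x \<in> N. P x \<in> A} \<le> emeasure \<nu> A"
    and Z0: "emeasure \<nu> (- Z) = 0" and Zb: "\<And>y. y \<in> Z \<Longrightarrow> norm (y - y0) \<le> D"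
  shows "\<exists>\<gamma>\<in>couplings \<mu> \<nu>. (\<integral>\<^sup>+ (x, y). ennreal (norm (x - y) ^ p) \<partial>\<gamma>) \<le>
    (\<integral>\<^sup>+ x\<in>N. ennreal (norm (x - P x) ^ p) \<partial>\<mu>) + (\<integral>\<^sup>+ x\<in>-N. ennreal ((norm (x - y0) + D) ^ p) \<partial>\<mu>)"
proof -
  interpret \<mu>: prob_space \<mu> by fact
  interpret \<nu>: prob_space \<nu> by fact
  have sp: "space \<mu> = UNIV" "space \<nu> = UNIV" using \<mu>(2) \<nu>(2) by (auto dest: sets_eq_imp_space_eq)
  note [measurable_cong] = \<mu>(2) \<nu>(2)
  \<comment> \<open>The image under \<open>P\<close> of the part of \<open>\<mu>\<close> in
    \<open>N\<close>; \<open>dom\<close> says that \<open>\<nu>\<close> dominates it.\<close>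
  define \<kappa> where "\<kappa> = distr (density \<mu> (indicator N)) borel P"
  have s\<kappa>[measurable_cong]: "sets \<kappa> = sets borel" by (simp add: \<kappa>_def)
  have \<kappa>: "emeasure \<kappa> A = emeasure \<mu> {x \<in> N. P x \<in> A}" if [measurable]: "A \<in> sets borel" for A
  proof -
    have "emeasure \<kappa> A = emeasure (density \<mu> (indicator N)) (P -` A)"
      unfolding \<kappa>_def by (subst emeasure_distr) (auto simp: sp)
    also have "\<dots> = (\<integral>\<^sup>+x. indicator N x * indicator (P -` A) x \<partial>\<mu>)"
      using measurable_sets[of P borel borel A] by (subst emeasure_density) (auto simp: \<mu>)
    also have "\<dots> = (\<integral>\<^sup>+x. indicator {x \<in> N. P x \<in> A} x \<partial>\<mu>)"
      by (rule nn_integral_cong) (auto simp: indicator_def)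
    also have "\<dots> = emeasure \<mu> {x \<in> N. P x \<in> A}" by (subst nn_integral_indicator) (auto simp: \<mu>)
    finally show ?thesis .
  qed
  have \<kappa>\<nu>: "emeasure \<kappa> A \<le> emeasure \<nu> A" if "A \<in> sets borel" for A using dom \<kappa> that by simp
  have fin: "finite_measure \<kappa>"
    by (rule finite_measureI) (use \<kappa>\<nu>[of UNIV] \<nu>.emeasure_space_1 in \<open>auto simp: \<kappa>_def sp top_unique\<close>)
  interpret \<kappa>: finite_measure \<kappa> by fact
  define r where "r = emeasure \<mu> (- N)"
  have r_le: "r \<le> 1" unfolding r_def by (rule \<mu>.measure_le_1)
  then have r_top: "r < top" using ennreal_one_less_top by (rule le_less_trans)
  have \<kappa>U: "emeasure \<kappa> UNIV + r = 1"
  proof -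
    have "emeasure \<mu> N + emeasure \<mu> (- N) = emeasure \<mu> UNIV"
      by (subst plus_emeasure) (auto simp: \<mu>)
    then show ?thesis using \<mu>.emeasure_space_1 by (simp add: \<kappa> r_def sp)
  qed
  \<comment> \<open>\<open>r\<close> is the mass of \<open>\<mu>\<close> off \<open>N\<close>, and
    equally the mass that \<open>\<kappa>\<close> lacks. If it is zero there is nothing to
    normalize; any probability measure carried by \<open>Z\<close> would do, and
    \<open>\<nu>\<close> is one.\<close>
  define \<rho> where "\<rho> = (if r = 0 then \<nu> else scale_measure (inverse r) (diff_measure \<nu> \<kappa>))"
  have s\<rho>[measurable_cong]: "sets \<rho> = sets borel" by (simp add: \<rho>_def \<nu>)
  have diff: "emeasure (diff_measure \<nu> \<kappa>) A = emeasure \<nu> A - emeasure \<kappa> A" if "A \<in> sets borel" for A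
    by (rule emeasure_diff_measure) (use that in \<open>auto simp: \<nu> \<kappa>\<nu> s\<kappa> \<nu>.finite_measure_axioms fin\<close>)
  have split: "emeasure \<kappa> A + r * emeasure \<rho> A = emeasure \<nu> A" if A: "A \<in> sets borel" for A
  proof (cases "r = 0")
    case True
    \<comment> \<open>For \<open>r = 0\<close> the measures \<open>\<kappa>\<close> and
      \<open>\<nu>\<close> have the same total mass, so domination on the complement of
      \<open>A\<close> forces equality on \<open>A\<close>.\<close>
    have "emeasure \<kappa> A + emeasure \<kappa> (- A) = 1" "emeasure \<nu> A + emeasure \<nu> (- A) = 1"
      using A \<kappa>U True \<nu>.emeasure_space_1 by (subst plus_emeasure; simp add: \<nu> sp s\<kappa>)+
    then have "emeasure \<nu> A + emeasure \<nu> (- A) \<le> emeasure \<kappa> A + emeasure \<nu> (- A)"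
      using \<kappa>\<nu>[of "- A"] A by (metis add_left_mono borel_comp)
    then have "emeasure \<nu> A \<le> emeasure \<kappa> A"
      by (auto simp: ennreal_add_left_cancel_le add.commute)
    then show ?thesis using \<kappa>\<nu>[OF A] True by simp
  next
    case False
    then have "r * emeasure \<rho> A = (r * inverse r) * (emeasure \<nu> A - emeasure \<kappa> A)"
      by (simp add: \<rho>_def diff[OF A] mult_ac)
    also have "r * inverse r = 1"
      using False r_top ennreal_divide_self[of r] by (simp add: divide_ennreal_def)
    finally show ?thesis using \<kappa>\<nu>[OF A] by (simp add: add_diff_inverse_ennreal)
  qed
  have \<rho>1: "emeasure \<rho> UNIV = 1"
  proof (cases "r = 0")
    case False
    have "emeasure \<kappa> UNIV + r * emeasure \<rho> UNIV = emeasure \<kappa> UNIV + r"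
      using split[of UNIV] \<kappa>U \<nu>.emeasure_space_1 by (simp add: sp)
    then have "r * emeasure \<rho> UNIV = r * 1"
      using \<kappa>.emeasure_finite[of UNIV] by (simp add: ennreal_add_left_cancel)
    then show ?thesis using False
      using r_top unfolding ennreal_mult_cancel_left by auto
  qed (use \<nu>.emeasure_space_1 in \<open>simp add: \<rho>_def sp\<close>)
  have sp\<rho>: "space \<rho> = UNIV" using s\<rho> by (auto dest: sets_eq_imp_space_eq)
  interpret \<rho>: prob_space \<rho> by standard (simp add: sp\<rho> \<rho>1)
  have \<rho>Z: "AE y in \<rho>. y \<in> Z"
  proof (rule AE_I[of _ _ "- Z"])
    show "emeasure \<rho> (- Z) = 0"
      using Z0 diff[of "- Z"] by (auto simp: \<rho>_def)
  qed auto
  \<comment> \<open>The second coordinate, drawn from \<open>\<rho>\<close>, is kept only for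
    \<open>x\<close> outside \<open>N\<close>. Both marginals and the cost can then be read off from
    the single formula \<open>int\<close>.\<close>
  define q where "q = (\<lambda>(x, y). (x, if x \<in> N then P x else y))"
  have q[measurable]: "q \<in> \<mu> \<Otimes>\<^sub>M \<rho> \<rightarrow>\<^sub>M borel"
    unfolding q_def borel_prod[symmetric] by measurable
  define \<gamma> where "\<gamma> = distr (\<mu> \<Otimes>\<^sub>M \<rho>) borel q"
  have int: "(\<integral>\<^sup>+z. g z \<partial>\<gamma>) = (\<integral>\<^sup>+x\<in>N. g (x, P x) \<partial>\<mu>) + (\<integral>\<^sup>+x\<in>-N. (\<integral>\<^sup>+y. g (x, y) \<partial>\<rho>) \<partial>\<mu>)"
    if g[measurable]: "g \<in> borel_measurable borel" for g :: "(real^'d) \<times> (real^'d) \<Rightarrow> ennreal"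
  proof -
    have [measurable]: "g \<in> borel_measurable (borel \<Otimes>\<^sub>M borel)" using g by (simp add: borel_prod)
    have "(\<integral>\<^sup>+z. g z \<partial>\<gamma>) = (\<integral>\<^sup>+z. g (q z) \<partial>(\<mu> \<Otimes>\<^sub>M \<rho>))"
      unfolding \<gamma>_def by (rule nn_integral_distr) auto
    also have "\<dots> = (\<integral>\<^sup>+x. (\<integral>\<^sup>+y. g (q (x, y)) \<partial>\<rho>) \<partial>\<mu>)"
      by (rule \<rho>.nn_integral_fst[symmetric]) measurable
    also have "\<dots> = (\<integral>\<^sup>+x. g (x, P x) * indicator N x + (\<integral>\<^sup>+y. g (x, y) \<partial>\<rho>) * indicator (-N) x \<partial>\<mu>)"
      by (rule nn_integral_cong) (auto simp: q_def indicator_def \<rho>1 sp\<rho>)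
    finally show ?thesis by (subst (asm) nn_integral_add) auto
  qed
  have sets\<gamma>: "sets \<gamma> = sets borel" by (simp add: \<gamma>_def)
  have m1: "distr \<gamma> borel fst = \<mu>"
  proof (rule measure_eqI)
    fix A assume "A \<in> sets (distr \<gamma> borel fst)"
    then have [measurable]: "A \<in> sets borel" by simp
    have [measurable]: "(fst :: (real^'d) \<times> (real^'d) \<Rightarrow> _) -` A \<in> sets borel"
      using measurable_sets[of "fst :: (real^'d) \<times> (real^'d) \<Rightarrow> _" borel borel A] by (simp add: borel_measurable_continuous_onI continuous_on_fst)
    have "emeasure (distr \<gamma> borel fst) A = (\<integral>\<^sup>+z. indicator (fst -` A) z \<partial>\<gamma>)"
      by (subst emeasure_distr) (auto simp: sets\<gamma> sets_eq_imp_space_eq[OF sets\<gamma>] measurable_cong_sets[OF sets\<gamma> refl] borel_measurable_continuous_onI continuous_on_fst)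
    also have "\<dots> = (\<integral>\<^sup>+x\<in>N. indicator A x \<partial>\<mu>) + (\<integral>\<^sup>+x\<in>-N. indicator A x \<partial>\<mu>)"
      by (subst int) (auto simp: indicator_def sp\<rho> \<rho>1)
    also have "\<dots> = (\<integral>\<^sup>+x. indicator A x * indicator N x + indicator A x * indicator (-N) x \<partial>\<mu>)"
      by (rule nn_integral_add[symmetric]) measurable
    also have "\<dots> = (\<integral>\<^sup>+x. indicator A x \<partial>\<mu>)"
      by (rule nn_integral_cong) (auto simp: indicator_def)
    finally show "emeasure (distr \<gamma> borel fst) A = emeasure \<mu> A" by (simp add: \<mu>)
  qed (simp add: \<mu>)
  have m2: "distr \<gamma> borel snd = \<nu>"
  proof (rule measure_eqI)
    fix A assume "A \<in> sets (distr \<gamma> borel snd)"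
    then have A[measurable]: "A \<in> sets borel" by simp
    have [measurable]: "(snd :: (real^'d) \<times> (real^'d) \<Rightarrow> _) -` A \<in> sets borel"
      using measurable_sets[of "snd :: (real^'d) \<times> (real^'d) \<Rightarrow> _" borel borel A] by (simp add: borel_measurable_continuous_onI continuous_on_snd)
    have "emeasure (distr \<gamma> borel snd) A = (\<integral>\<^sup>+z. indicator (snd -` A) z \<partial>\<gamma>)"
      by (subst emeasure_distr) (auto simp: sets\<gamma> sets_eq_imp_space_eq[OF sets\<gamma>] measurable_cong_sets[OF sets\<gamma> refl] borel_measurable_continuous_onI continuous_on_snd)
    also have "\<dots> = (\<integral>\<^sup>+x\<in>N. indicator A (P x) \<partial>\<mu>) + (\<integral>\<^sup>+x\<in>-N. (\<integral>\<^sup>+y. indicator A y \<partial>\<rho>) \<partial>\<mu>)"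
      by (subst int) (auto simp del: nn_integral_indicator simp: indicator_vimage comp_def)
    also have "(\<integral>\<^sup>+x\<in>N. indicator A (P x) \<partial>\<mu>) = (\<integral>\<^sup>+x. indicator {x\<in>N. P x \<in> A} x \<partial>\<mu>)"
      by (rule nn_integral_cong) (auto simp: indicator_def)
    also have "\<dots> = emeasure \<kappa> A" by (subst nn_integral_indicator) (auto simp: \<mu> \<kappa>)
    also have "(\<integral>\<^sup>+x\<in>-N. (\<integral>\<^sup>+y. indicator A y \<partial>\<rho>) \<partial>\<mu>) = r * emeasure \<rho> A"
      by (simp add: s\<rho> nn_integral_cmult_indicator \<mu> r_def mult.commute)
    finally show "emeasure (distr \<gamma> borel snd) A = emeasure \<nu> A" by (simp add: split)
  qed (simp add: \<nu>)
  have "\<gamma> \<in> couplings \<mu> \<nu>" using sets\<gamma> m1 m2 by (simp add: couplings_def)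
  moreover have "(\<integral>\<^sup>+ (x, y). ennreal (norm (x - y) ^ p) \<partial>\<gamma>) \<le>
    (\<integral>\<^sup>+ x\<in>N. ennreal (norm (x - P x) ^ p) \<partial>\<mu>) + (\<integral>\<^sup>+ x\<in>-N. ennreal ((norm (x - y0) + D) ^ p) \<partial>\<mu>)"
  proof -
    \<comment> \<open>\<open>\<rho>\<close> is carried by \<open>Z\<close>, so every partner lies
      within \<open>D\<close> of \<open>y0\<close>, and the triangle inequality removes
      \<open>\<rho>\<close> from the cost.\<close>
    have *: "(\<integral>\<^sup>+y. ennreal (norm (x - y) ^ p) \<partial>\<rho>) \<le> ennreal ((norm (x - y0) + D) ^ p)" for x
    proof -
      have "(\<integral>\<^sup>+y. ennreal (norm (x - y) ^ p) \<partial>\<rho>) \<le> (\<integral>\<^sup>+y. ennreal ((norm (x - y0) + D) ^ p) \<partial>\<rho>)"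
        using \<rho>Z
      proof (intro nn_integral_mono_AE, eventually_elim)
        fix y assume "y \<in> Z"
        then have "norm (x - y) \<le> norm (x - y0) + D"
          using norm_triangle_ineq[of "x - y0" "y0 - y"] Zb[of y] by (simp add: norm_minus_commute)
        then show "ennreal (norm (x - y) ^ p) \<le> ennreal ((norm (x - y0) + D) ^ p)"
          by (intro ennreal_leI power_mono) auto
      qed
      then show ?thesis by (simp add: \<rho>1 sp\<rho>)
    qed
    have "(\<lambda>(x, y). ennreal (norm (x - y) ^ p)) \<in> borel_measurable (borel :: ((real^'d) \<times> (real^'d)) measure)"
      unfolding borel_prod[symmetric] by measurable
    from int[OF this] show ?thesis
      by (auto intro!: nn_integral_mono add_left_mono mult_right_mono *)
  qed
  ultimately show ?thesis by blast
qed

text \<open>One coupling bounds the infimum. The finite bound excludes the infinite branch in the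
  definition of \<open>wasserstein\<close>, and \<open>p \<ge> 1\<close> lets \<open>root p\<close>
  undo the power.\<close>

lemma wasserstein_le_of_coupling:
  assumes "\<gamma> \<in> couplings \<mu> \<nu>" "p \<ge> 1" "0 \<le> C"
    "(\<integral>\<^sup>+ (x, y). ennreal (norm (x - y) ^ p) \<partial>\<gamma>) \<le> ennreal (C ^ p)"
  shows "wasserstein p \<mu> \<nu> \<le> ennreal C"
proof -
  define c where "c = (INF \<gamma>\<in>couplings \<mu> \<nu>. \<integral>\<^sup>+ (x, y). ennreal (norm (x - y) ^ p) \<partial>\<gamma>)"
  have c: "c \<le> ennreal (C ^ p)" unfolding c_def using assms by (meson INF_lower order_trans)
  then have "c \<noteq> \<infinity>" by (auto simp: top_unique)
  moreover have "enn2real c \<le> C ^ p" using c assms(3) by (simp add: enn2real_leI)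
  then have "root p (enn2real c) \<le> C"
    using assms(2,3) by (metis One_nat_def Suc_le_eq real_root_le_iff real_root_power_cancel)
  ultimately show ?thesis by (simp add: wasserstein_def c_def[symmetric] ennreal_leI)
qed

section \<open>Gaussian moments\<close>

text \<open>A single term of the exponential series is at most its sum.\<close>

lemma power_times_exp_le:
  fixes c x :: real
  assumes "c > 0" "x \<ge> 0"
  shows "x ^ q * exp (- (c * x)) \<le> fact q / c ^ q"
proof -
  have "(c * x) ^ q / fact q \<le> exp (c * x)"
  proof -
    have "(\<Sum>k\<in>{q}. (c * x) ^ k /\<^sub>R fact k) \<le> exp (c * x)"
      unfolding exp_def by (rule sum_le_suminf) (use assms summable_exp_generic[of "c * x"] in auto)
    then show ?thesis by (simp add: divide_inverse mult.commute)
  qed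
  then show ?thesis
    using assms by (simp add: field_simps exp_minus power_mult_distrib)
qed

lemma summable_power_times_gaussian:
  fixes c :: real
  assumes "c > 0"
  shows "summable (\<lambda>k. (real k + 1) ^ q * exp (- (c * (real k)\<^sup>2)))"
proof (rule summable_comparison_test'[where N = 0])
  \<comment> \<open>A natural number is at most its square, so the Gaussian factor is at most an
    exponential. Its decay absorbs \<open>q + 2\<close> powers of \<open>k + 1\<close>, two more
    than occur, which leaves a convergent series of inverse squares; \<open>exp c\<close> pays for
    the shift from \<open>k\<close> to \<open>k + 1\<close>.\<close>
  define B where "B = fact (q + 2) / c ^ (q + 2) * exp c"
  have "summable (\<lambda>k. inverse ((real (Suc k)) ^ 2))"
    by (subst summable_Suc_iff) (rule inverse_power_summable, simp)
  then show "summable (\<lambda>k. B * inverse ((real k + 1) ^ 2))"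
    by (intro summable_mult) (simp add: add.commute)
  fix k :: nat
  have "real k \<le> (real k)\<^sup>2" by (cases k) (auto simp: power2_eq_square field_simps)
  then have "exp (- (c * (real k)\<^sup>2)) \<le> exp (- (c * real k))"
    using assms by simp
  also have "\<dots> = exp (- (c * (real k + 1))) * exp c"
    by (simp add: exp_add[symmetric] algebra_simps)
  finally have "(real k + 1) ^ (q + 2) * exp (- (c * (real k)\<^sup>2)) \<le>
      (real k + 1) ^ (q + 2) * (exp (- (c * (real k + 1))) * exp c)"
    by (intro mult_left_mono) auto
  also have "\<dots> \<le> B"
    unfolding B_def mult.assoc[symmetric]
    by (intro mult_right_mono power_times_exp_le) (use assms in auto)
  finally show "norm ((real k + 1) ^ q * exp (- (c * (real k)\<^sup>2))) \<le> B * inverse ((real k + 1) ^ 2)"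
    by (simp add: pos_le_divide_eq divide_inverse[symmetric] power2_eq_square mult_ac)
qed

text \<open>Cut the space into shells of width \<open>R\<close>, the inverse square root of
  \<open>n\<close>. On the k-th shell the Gaussian factor has a bound free of \<open>n\<close>, and
  the shell lies in the ball of radius \<open>(k + 1) * R\<close>, whose volume contributes the
  power \<open>DIM('a)\<close>. The series that remains converges and does not depend on
  \<open>n\<close>.\<close>

lemma nn_integral_gaussian_moment:
  fixes c :: real
  assumes c: "c > 0"
  shows "\<exists>K\<ge>0. \<forall>n\<ge>1. (\<integral>\<^sup>+ t. ennreal (norm t ^ p * exp (- (real n * (c * (norm t)\<^sup>2)))) \<partial>(lborel :: 'a::euclidean_space measure))
    \<le> ennreal (K * (1 / sqrt (real n)) ^ (p + DIM('a)))"
proof -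
  define V where "V = unit_ball_vol (real DIM('a))"
  have V: "V \<ge> 0" by (simp add: V_def)
  define s where "s k = (real k + 1) ^ (p + DIM('a)) * exp (- (c * (real k)\<^sup>2))" for k
  have s: "summable s" "\<And>k. s k \<ge> 0"
    using summable_power_times_gaussian[OF c] by (auto simp: s_def[abs_def])
  define K where "K = V * suminf s"
  show ?thesis
  proof (intro exI[of _ K] conjI allI impI)
    show "K \<ge> 0" unfolding K_def using V s by (auto intro!: mult_nonneg_nonneg suminf_nonneg)
    fix n :: nat assume n: "n \<ge> 1"
    define R where "R = 1 / sqrt (real n)"
    have R: "R > 0" "sqrt (real n) * R = 1" using n by (auto simp: R_def)
    define a where "a k = ((real k + 1) * R) ^ p * exp (- (c * (real k)\<^sup>2))" for k
    have a: "a k \<ge> 0" for k using R by (auto simp: a_def)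
    have "(\<integral>\<^sup>+ t. ennreal (norm t ^ p * exp (- (real n * (c * (norm t)\<^sup>2)))) \<partial>(lborel :: 'a measure))
      \<le> (\<integral>\<^sup>+ t. (\<Sum>k. ennreal (a k) * indicator (ball 0 ((real k + 1) * R)) t) \<partial>(lborel :: 'a measure))"
    proof (rule nn_integral_mono)
      fix t :: 'a
      \<comment> \<open>The index of the shell that contains \<open>t\<close>; this one term of the
        series already dominates the integrand.\<close>
      define k where "k = nat \<lfloor>sqrt (real n) * norm t\<rfloor>"
      have k: "real k \<le> sqrt (real n) * norm t" "sqrt (real n) * norm t < real k + 1"
        unfolding k_def by (auto simp: nat_floor_neg le_nat_floor)
      have t: "norm t < (real k + 1) * R"
        using mult_strict_right_mono[OF k(2) R(1)] R(2) by (metis mult.commute mult.left_commute mult_1)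
      have "(real k)\<^sup>2 \<le> real n * (norm t)\<^sup>2"
        using power_mono[OF k(1), of 2] by (simp add: power_mult_distrib)
      then have "c * (real k)\<^sup>2 \<le> real n * (c * (norm t)\<^sup>2)"
        using c by (simp add: mult.left_commute[of "real n"])
      then have "norm t ^ p * exp (- (real n * (c * (norm t)\<^sup>2))) \<le> a k"
        unfolding a_def using t R by (intro mult_mono power_mono) auto
      then have "ennreal (norm t ^ p * exp (- (real n * (c * (norm t)\<^sup>2)))) \<le>
          (\<Sum>j\<in>{k}. ennreal (a j) * indicator (ball 0 ((real j + 1) * R)) t)"
        using t by (auto intro: ennreal_leI)
      also have "\<dots> \<le> (\<Sum>j. ennreal (a j) * indicator (ball 0 ((real j + 1) * R)) t)"
        by (rule sum_le_suminf) auto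
      finally show "ennreal (norm t ^ p * exp (- (real n * (c * (norm t)\<^sup>2)))) \<le> \<dots>" .
    qed
    also have "\<dots> = (\<Sum>k. ennreal (a k) * emeasure lborel (ball (0::'a) ((real k + 1) * R)))"
    proof (subst nn_integral_suminf)
      show "(\<lambda>t::'a. ennreal (a k) * indicator (ball 0 ((real k + 1) * R)) t) \<in> borel_measurable lborel" for k
        by (intro borel_measurable_times_ennreal borel_measurable_const borel_measurable_indicator) simp
    qed (simp add: nn_integral_cmult_indicator)
    also have "\<dots> = (\<Sum>k. ennreal (V * R ^ (p + DIM('a)) * s k))"
      using R by (intro suminf_cong)
        (simp add: emeasure_ball V_def a_def s_def ennreal_mult'[symmetric] power_mult_distrib power_add mult_ac)
    also have "\<dots> = ennreal (\<Sum>k. V * R ^ (p + DIM('a)) * s k)"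
      by (rule suminf_ennreal2) (use s R V in \<open>auto intro!: mult_nonneg_nonneg summable_mult\<close>)
    also have "\<dots> = ennreal (K * R ^ (p + DIM('a)))"
      unfolding K_def suminf_mult[OF s(1)] by (simp add: mult_ac)
    finally show "(\<integral>\<^sup>+ t. ennreal (norm t ^ p * exp (- (real n * (c * (norm t)\<^sup>2)))) \<partial>(lborel :: 'a measure))
      \<le> ennreal (K * (1 / sqrt (real n)) ^ (p + DIM('a)))" by (simp add: R_def)
  qed
qed

section \<open>Tubular neighbourhoods\<close>

lemma continuous_on_smooth_map:
  assumes "smooth_map f A"
  shows "continuous_on A f"
  unfolding continuous_on_eq_continuous_within
proof
  fix x assume x: "x \<in> A"
  then obtain U F where U: "x \<in> U" "smooth_on_open F U" and eq: "\<forall>y\<in>U \<inter> A. F y = f y"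
    using assms by (auto simp: smooth_map_def)
  from U(2) have "open U" "Ck_on 0 F U" by (auto simp: smooth_on_open_def)
  then obtain d where d: "d > 0" "ball x d \<subseteq> U" and "isCont F x"
    using U(1) by (meson openE Ck_on.simps(1) continuous_on_eq_continuous_at)
  show "continuous (at x within A) f"
  proof (rule continuous_transform_within[of x A F d f])
    show "continuous (at x within A) F"
      using \<open>isCont F x\<close> by (rule continuous_at_imp_continuous_at_within)
    show "F y = f y" if "y \<in> A" "dist y x < d" for y
      using eq d(2) that by (auto simp: dist_commute subset_iff)
  qed (use d x in auto)
qed

text \<open>Tube lemma: the points where the bound fails form a compact set, whose projection to the
  first factor is closed and misses 0.\<close>

lemma compact_neighbourhood_gt:
  fixes f :: "'a::euclidean_space \<times> 'b::euclidean_space \<Rightarrow> real"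
  assumes K: "compact K" and r: "r > 0" and f: "continuous_on (cball 0 r \<times> K) f"
    and gt: "\<And>u. u \<in> K \<Longrightarrow> f (0, u) > a"
  shows "\<exists>\<delta>>0. \<delta> \<le> r \<and> (\<forall>t u. norm t \<le> \<delta> \<longrightarrow> u \<in> K \<longrightarrow> f (t, u) > a)"
proof -
  define C where "C = {z \<in> cball 0 r \<times> K. f z \<le> a}"
  have "compact (cball (0::'a) r \<times> K)" using K by (intro compact_Times) auto
  then have "compact C" unfolding C_def
    using continuous_on_closed_Collect_le[OF f continuous_on_const compact_imp_closed]
    by (simp add: Collect_conj_eq compact_Int_closed)
      (metis (no_types, lifting) Collect_conj_eq Collect_mem_eq bounded_subset compact_eq_bounded_closed inf_le1)
  then have "closed (fst ` C)"
    by (intro compact_imp_closed compact_continuous_image continuous_intros)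
  moreover have "0 \<notin> fst ` C" using gt by (force simp: C_def)
  ultimately obtain e where e: "e > 0" "ball 0 e \<subseteq> - fst ` C"
    by (meson open_Compl openE ComplI)
  show ?thesis
  proof (intro exI[of _ "min r (e / 2)"] conjI allI impI)
    fix t :: 'a and u assume t: "norm t \<le> min r (e / 2)" and u: "u \<in> K"
    then have "t \<in> ball 0 e" using e by auto
    then have "t \<notin> fst ` C" using e by blast
    then have "(t, u) \<notin> C" by force
    then show "f (t, u) > a" using t u by (auto simp: C_def)
  qed (use r e in auto)
qed

lemma compact_uniform_pos:
  fixes f :: "'a::topological_space \<Rightarrow> real"
  assumes "compact K" "continuous_on K f" "\<And>u. u \<in> K \<Longrightarrow> f u > 0"
  shows "\<exists>c>0. \<forall>u\<in>K. f u > c"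
proof (cases "K = {}")
  case False
  from continuous_attains_inf[OF assms(1) this assms(2)] obtain u where "u \<in> K" "\<And>y. y \<in> K \<Longrightarrow> f u \<le> f y"
    by auto
  then show ?thesis using assms(3)[of u] by (intro exI[of _ "f u / 2"]) force
qed (auto intro: exI[of _ 1])

lemma compact_uniform_bound:
  fixes f :: "'a::topological_space \<Rightarrow> real"
  assumes "compact K" "continuous_on K f"
  shows "\<exists>C>0. \<forall>u\<in>K. \<bar>f u\<bar> \<le> C"
  using compact_imp_bounded[OF compact_continuous_image[OF assms(2,1)]]
  by (auto simp: bounded_pos)

text \<open>One manifold with its frame, tube and Weyl coefficients, so that all estimates are
  proved once and then summed over the finitely many manifolds.\<close>

locale tube =
  fixes M :: "(real^'d) set" and v :: "'c::finite \<Rightarrow> real^'d \<Rightarrow> real^'d"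
    and \<nu> :: "(real^'d) measure" and \<epsilon> :: real
    and G :: "'c \<Rightarrow> 'k::finite \<Rightarrow> 'k \<Rightarrow> real^'d \<Rightarrow> real"
  assumes compact_M: "compact M"
    and frame: "normal_frame M v"
    and radius: "tubular_radius M \<epsilon>"
    and sets_\<nu>: "sets \<nu> = sets (restrict_space borel M)"
    and weyl: "weyl_coefficients M v \<nu> \<epsilon> G"
begin

lemma \<epsilon>_pos: "\<epsilon> > 0"
  using radius by (simp add: tubular_radius_def)

lemma space_\<nu>: "space \<nu> = M"
  using sets_eq_imp_space_eq[OF sets_\<nu>] by (simp add: space_restrict_space)

lemma open_nbhd: "open (tubular_nbhd M \<epsilon>)"
  using radius by (simp add: tubular_radius_def)

text \<open>Orthonormality of the frame. It places a point of the tube at distance exactly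
  \<open>norm t\<close> from its foot point, which turns the transport cost into a Gaussian
  moment.\<close>

lemma norm_normal:
  assumes "u \<in> M"
  shows "norm (\<Sum>j\<in>UNIV. (t $ j) *\<^sub>R v j u) = norm t"
proof -
  have "(\<Sum>i\<in>UNIV. (t $ i) *\<^sub>R v i u) \<bullet> (\<Sum>j\<in>UNIV. (t $ j) *\<^sub>R v j u) =
      (\<Sum>i\<in>UNIV. \<Sum>j\<in>UNIV. if i = j then (t $ i) * (t $ j) else 0)"
    unfolding inner_sum_left inner_sum_right
    by (subst sum.swap, intro sum.cong refl) (use frame assms in \<open>auto simp: normal_frame_def\<close>)
  also have "\<dots> = t \<bullet> t" by (simp add: inner_vec_def)
  finally show ?thesis by (simp add: norm_eq_sqrt_inner)
qed

lemma dist_tube_map: "u \<in> M \<Longrightarrow> norm (tube_map v t u - u) = norm t"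
  by (simp add: tube_map_def norm_normal)

lemma normal_bundle_ballI:
  assumes "u \<in> M" "norm t < \<delta>"
  shows "(u, \<Sum>j\<in>UNIV. (t $ j) *\<^sub>R v j u) \<in> normal_bundle_ball M \<delta>"
proof -
  have "(\<Sum>j\<in>UNIV. (t $ j) *\<^sub>R v j u) \<in> span (range (\<lambda>j. v j u))"
    by (intro span_sum span_scale span_base) auto
  then show ?thesis
    using assms frame by (simp add: normal_bundle_ball_def norm_normal normal_frame_def)
qed

lemma tube_map_in_nbhd: "u \<in> M \<Longrightarrow> norm t < \<delta> \<Longrightarrow> tube_map v t u \<in> tubular_nbhd M \<delta>"
  using normal_bundle_ballI[of u t \<delta>] by (force simp: tubular_nbhd_def tube_map_def)

lemma inj_normal_bundle_ball: "inj_on (\<lambda>(u, w). u + w) (normal_bundle_ball M \<epsilon>)"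
  using radius by (simp add: tubular_radius_def diffeomorphism_def bij_betw_def)

text \<open>Points of the large tube have a unique representation, so one that lies in the smaller
  tube has a short normal part. Contrapositively, \<open>norm t \<ge> \<delta>\<close> puts the
  point where condition (T) bounds \<open>l\<close> from below.\<close>

lemma norm_less_of_in_nbhd:
  assumes "u \<in> M" "norm t < \<epsilon>" "\<delta> \<le> \<epsilon>" "tube_map v t u \<in> tubular_nbhd M \<delta>"
  shows "norm t < \<delta>"
proof -
  obtain z where z: "z \<in> normal_bundle_ball M \<delta>" "tube_map v t u = (\<lambda>(u, w). u + w) z"
    using assms(4) by (auto simp: tubular_nbhd_def)
  then have "z \<in> normal_bundle_ball M \<epsilon>" using assms(3) by (auto simp: normal_bundle_ball_def)
  then have "z = (u, \<Sum>j\<in>UNIV. (t $ j) *\<^sub>R v j u)"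
    using inj_onD[OF inj_normal_bundle_ball, of z "(u, \<Sum>j\<in>UNIV. (t $ j) *\<^sub>R v j u)"]
      z(2) normal_bundle_ballI[OF assms(1,2)] by (simp add: tube_map_def)
  then show ?thesis using z(1) norm_normal[OF assms(1)] by (simp add: normal_bundle_ball_def)
qed

lemma bounded_nbhd: "bounded (tubular_nbhd M \<epsilon>)"
proof -
  obtain B where B: "\<And>u. u \<in> M \<Longrightarrow> norm u \<le> B"
    using compact_imp_bounded[OF compact_M] by (auto simp: bounded_iff)
  have "norm x \<le> B + \<epsilon>" if x: "x \<in> tubular_nbhd M \<epsilon>" for x
  proof -
    obtain u w where "x = u + w" "u \<in> M" "norm w < \<epsilon>"
      using x by (auto simp: tubular_nbhd_def normal_bundle_ball_def)
    then show ?thesis using norm_triangle_ineq[of u w] B[of u] by simp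
  qed
  then show ?thesis by (auto simp: bounded_iff)
qed

definition foot :: "real^'d \<Rightarrow> real^'d" where
  "foot x = fst (inv_into (normal_bundle_ball M \<epsilon>) (\<lambda>(u, w). u + w) x)"

lemma foot_tube_map:
  assumes "u \<in> M" "norm t < \<epsilon>"
  shows "foot (tube_map v t u) = u"
  using inv_into_f_f[OF inj_normal_bundle_ball normal_bundle_ballI[OF assms]]
  by (simp add: foot_def tube_map_def)

text \<open>The notion \<open>diffeomorphism\<close> includes smoothness of the inverse. The
  measurability of the transport map rests on this.\<close>

lemma continuous_on_foot: "continuous_on (tubular_nbhd M \<epsilon>) foot"
proof -
  have "smooth_map (inv_into (normal_bundle_ball M \<epsilon>) (\<lambda>(u, w). u + w)) (tubular_nbhd M \<epsilon>)"
    using radius by (simp add: tubular_radius_def diffeomorphism_def)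
  from continuous_on_fst[OF continuous_on_smooth_map[OF this]] show ?thesis
    by (simp add: foot_def[abs_def])
qed

lemma continuous_on_frame:
  "continuous_on T u \<Longrightarrow> u ` T \<subseteq> M \<Longrightarrow> continuous_on T (\<lambda>z. v j (u z))"
  using frame by (auto simp: normal_frame_def intro: continuous_on_compose2[OF continuous_on_smooth_map])

lemma continuous_on_normal:
  assumes "continuous_on T t" "continuous_on T u" "u ` T \<subseteq> M"
  shows "continuous_on T (\<lambda>z. \<Sum>j\<in>UNIV. (t z $ j) *\<^sub>R v j (u z))"
  using assms by (intro continuous_intros continuous_on_frame)

lemma continuous_on_weyl_h:
  assumes "continuous_on T t" "continuous_on T u" "u ` T \<subseteq> M"
  shows "continuous_on T (\<lambda>z. weyl_h G (t z) (u z))"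
proof -
  have "continuous_on M (G j a b)" for j a b
    using weyl by (simp add: weyl_coefficients_def continuous_on_smooth_map)
  from continuous_on_compose2[OF this assms(2,3)]
  have "continuous_on T (\<lambda>z. G j a b (u z))" for j a b .
  then show ?thesis
    unfolding weyl_h_def det_def using assms by (auto intro!: continuous_intros)
qed

lemma weyl_h_0: "weyl_h G 0 u = 1"
proof -
  have "(\<chi> a b. (if a = b then 1 else 0) + (\<Sum>j\<in>UNIV. ((0::real^'c) $ j) * G j a b u)) = (mat 1 :: real^'k^'k)"
    by (simp add: mat_def vec_eq_iff)
  then show ?thesis by (simp add: weyl_h_def)
qed

lemma weyl_h_bound: "\<exists>H>0. \<forall>t u. norm t \<le> \<epsilon> \<longrightarrow> u \<in> M \<longrightarrow> \<bar>weyl_h G t u\<bar> \<le> H"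
proof -
  have "continuous_on (cball 0 \<epsilon> \<times> M) (\<lambda>z. weyl_h G (fst z) (snd z))"
    by (intro continuous_on_weyl_h continuous_intros) auto
  from compact_uniform_bound[OF _ this] compact_M show ?thesis
    by (auto simp: compact_Times)
qed

text \<open>At \<open>t = 0\<close> the density is 1, and compactness of \<open>M\<close> makes the
  neighbourhood uniform in \<open>u\<close>. This is what lets Weyl's formula yield lower
  bounds.\<close>

lemma weyl_h_lower: "\<exists>\<delta>>0. \<delta> < \<epsilon> \<and> (\<forall>t u. norm t \<le> \<delta> \<longrightarrow> u \<in> M \<longrightarrow> weyl_h G t u > 1 / 2)"
proof -
  have "continuous_on (cball 0 (\<epsilon> / 2) \<times> M) (\<lambda>z. weyl_h G (fst z) (snd z))"
    by (intro continuous_on_weyl_h continuous_intros) auto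
  from compact_neighbourhood_gt[OF compact_M _ this, of "1/2"] \<epsilon>_pos obtain \<delta> where
    "\<delta> > 0" "\<delta> \<le> \<epsilon> / 2" "\<forall>t u. norm t \<le> \<delta> \<longrightarrow> u \<in> M \<longrightarrow> weyl_h G t u > 1 / 2"
    by (auto simp: weyl_h_0)
  then show ?thesis using \<epsilon>_pos by (intro exI[of _ \<delta>]) auto
qed

lemma weyl_h_nonneg: "u \<in> M \<Longrightarrow> norm t < \<epsilon> \<Longrightarrow> weyl_h G t u \<ge> 0"
  using weyl by (auto simp: weyl_coefficients_def)

lemma weyl_formula:
  "f \<in> borel_measurable borel \<Longrightarrow> (\<integral>\<^sup>+ x\<in>tubular_nbhd M \<epsilon>. f x \<partial>lborel) =
    (\<integral>\<^sup>+ u. (\<integral>\<^sup>+ t\<in>ball 0 \<epsilon>. f (tube_map v t u) * ennreal (weyl_h G t u) \<partial>lborel) \<partial>\<nu>)"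
  using weyl by (simp add: weyl_coefficients_def)

lemma nbhd_nonempty: "M \<noteq> {} \<Longrightarrow> tubular_nbhd M \<epsilon> \<noteq> {}"
  using tube_map_in_nbhd[of _ 0 \<epsilon>] \<epsilon>_pos by fastforce

lemma emeasure_nbhd: "emeasure lborel (tubular_nbhd M \<epsilon>) =
    (\<integral>\<^sup>+ u. (\<integral>\<^sup>+ t\<in>ball 0 \<epsilon>. ennreal (weyl_h G t u) \<partial>lborel) \<partial>\<nu>)"
  using weyl_formula[of "\<lambda>_. 1"] open_nbhd by simp

text \<open>Finiteness and positivity of the volume follow from Weyl's formula, without local charts.\<close>

lemma emeasure_\<nu>_finite: "emeasure \<nu> M < top"
proof -
  obtain \<delta> where \<delta>: "\<delta> > 0" "\<delta> < \<epsilon>" and h: "\<And>t u. norm t \<le> \<delta> \<Longrightarrow> u \<in> M \<Longrightarrow> weyl_h G t u > 1 / 2"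
    using weyl_h_lower by blast
  \<comment> \<open>A lower bound, independent of \<open>u\<close>, for the inner integral of Weyl's
    formula with integrand 1. Multiplied by the volume of \<open>M\<close>, it is at most the
    Lebesgue measure of the bounded tube.\<close>
  define a where "a = ennreal (1 / 2) * emeasure lborel (ball (0::real^'c) \<delta>)"
  have a: "a > 0" using \<delta> by (simp add: a_def emeasure_ball ennreal_zero_less_mult_iff del: ennreal_half)
  have "a * emeasure \<nu> M = (\<integral>\<^sup>+ u. a \<partial>\<nu>)" by (simp add: space_\<nu>)
  also have "\<dots> \<le> emeasure lborel (tubular_nbhd M \<epsilon>)"
    unfolding emeasure_nbhd
  proof (rule nn_integral_mono)
    fix u assume "u \<in> space \<nu>"
    then have u: "u \<in> M" by (simp add: space_\<nu>)
    have "a = (\<integral>\<^sup>+ t. ennreal (1 / 2) * indicator (ball (0::real^'c) \<delta>) t \<partial>lborel)"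
      by (simp add: a_def nn_integral_cmult_indicator)
    also have "\<dots> \<le> (\<integral>\<^sup>+ t\<in>ball 0 \<epsilon>. ennreal (weyl_h G t u) \<partial>lborel)"
    proof (rule nn_integral_mono)
      fix t :: "real^'c"
      have "ennreal (1 / 2) \<le> ennreal (weyl_h G t u)" if "norm t < \<delta>"
        using h[of t u] u that by (intro ennreal_leI) auto
      then show "ennreal (1 / 2) * indicator (ball 0 \<delta>) t \<le> ennreal (weyl_h G t u) * indicator (ball 0 \<epsilon>) t"
        using \<delta> by (auto simp: indicator_def)
    qed
    finally show "a \<le> (\<integral>\<^sup>+ t\<in>ball 0 \<epsilon>. ennreal (weyl_h G t u) \<partial>lborel)" .
  qed
  also have "\<dots> < top" using emeasure_bounded_finite[OF bounded_nbhd] by simp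
  finally show ?thesis using a by (cases "emeasure \<nu> M = top") (auto simp: ennreal_mult_eq_top_iff less_top)
qed

lemma finite_measure_\<nu>: "finite_measure \<nu>"
  by (rule finite_measureI) (use emeasure_\<nu>_finite in \<open>simp add: space_\<nu>\<close>)

lemma emeasure_\<nu>_pos:
  assumes "M \<noteq> {}"
  shows "emeasure \<nu> M > 0"
proof (rule ccontr)
  assume "\<not> emeasure \<nu> M > 0"
  then have 0: "emeasure \<nu> (space \<nu>) = 0" by (simp add: space_\<nu>)
  \<comment> \<open>Over a null measure the outer integral in Weyl's formula vanishes, which is
    impossible for a nonempty open tube.\<close>
  have "emeasure lborel (tubular_nbhd M \<epsilon>) = 0"
  proof -
    have "AE u in \<nu>. False" by (rule AE_I[of _ _ "space \<nu>"]) (use 0 in auto)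
    then have "(\<integral>\<^sup>+ u. (\<integral>\<^sup>+ t\<in>ball 0 \<epsilon>. ennreal (weyl_h G t u) \<partial>lborel) \<partial>\<nu>) = (\<integral>\<^sup>+ u. 0 \<partial>\<nu>)"
      by (intro nn_integral_cong_AE) auto
    then show ?thesis by (simp add: emeasure_nbhd)
  qed
  moreover obtain x r where "r > 0" "ball x r \<subseteq> tubular_nbhd M \<epsilon>"
    using open_nbhd nbhd_nonempty[OF assms] by (meson ex_in_conv openE)
  ultimately have "emeasure lborel (ball x r) = 0"
    by (metis borel_open emeasure_eq_0 open_nbhd sets_lborel)
  then show False
    using \<open>r > 0\<close> unit_ball_vol_pos[of "real CARD('d)"] by (simp add: emeasure_ball)
qed

lemma continuous_on_imp_measurable_\<nu>:
  fixes f :: "real^'d \<Rightarrow> real"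
  assumes "continuous_on M f"
  shows "f \<in> borel_measurable \<nu>"
  using borel_measurable_continuous_on_restrict[OF assms] measurable_cong_sets[OF sets_\<nu> refl] by blast

end

text \<open>Definiteness makes the kernel trivial. A nonzero base is what gives continuity and
  positivity of the power -1/2 in \<open>laplace_weight\<close>.\<close>

lemma det_nonzero_if_pos_definite:
  fixes A :: "real^'n^'n"
  assumes "pos_definite A"
  shows "det A \<noteq> 0"
proof -
  have "\<forall>x. A *v x = 0 \<longrightarrow> x = 0"
    using assms by (force simp: pos_definite_def)
  then show ?thesis
    using matrix_left_invertible_ker[of A] invertible_left_inverse[of A] invertible_det_nz[of A] by auto
qed

section \<open>Gibbs measures in a tubular neighbourhood\<close>

text \<open>\<open>sep\<close> is condition (T) localized to one tube, and \<open>U\<close> stands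
  for the interior of the set F in condition (S).\<close>

locale gibbs_tube = tube M v \<nu> \<epsilon> G
  for M :: "(real^'d) set" and v :: "'c::finite \<Rightarrow> real^'d \<Rightarrow> real^'d"
    and \<nu> :: "(real^'d) measure" and \<epsilon> :: real
    and G :: "'c \<Rightarrow> 'k::finite \<Rightarrow> 'k \<Rightarrow> real^'d \<Rightarrow> real" +
  fixes \<pi>0 l :: "real^'d \<Rightarrow> real" and U :: "(real^'d) set"
  assumes open_U: "open U" and C2: "Ck_on 2 l U" and nbhd_U: "tubular_nbhd M \<epsilon> \<subseteq> U"
    and l_meas[measurable]: "l \<in> borel_measurable borel" and l_nonneg: "\<And>x. l x \<ge> 0"
    and l_0: "\<And>u. u \<in> M \<Longrightarrow> l u = 0"
    and cont_\<pi>0: "continuous_on UNIV \<pi>0" and \<pi>0_pos: "\<And>x. \<pi>0 x > 0"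
    and pos_def: "\<And>u. u \<in> M \<Longrightarrow> pos_definite (hessian (\<lambda>t. l (tube_map v t u)) 0)"
    and sep: "\<And>\<delta>. 0 < \<delta> \<Longrightarrow> \<delta> \<le> \<epsilon> \<Longrightarrow> \<exists>c>0. \<forall>x\<in>tubular_nbhd M \<epsilon> - tubular_nbhd M \<delta>. l x \<ge> c"
begin

lemma \<pi>0_meas[measurable]: "\<pi>0 \<in> borel_measurable borel"
  using cont_\<pi>0 by (rule borel_measurable_continuous_onI)

lemma hessian_eq:
  assumes "u \<in> M"
  shows "hessian (\<lambda>t. l (tube_map v t u)) 0 = (\<chi> a b. dir2 l u (v b u) (v a u))"
  unfolding tube_map_def
  by (rule hessian_affine[OF open_U C2 \<epsilon>_pos])
    (use nbhd_U tube_map_in_nbhd[OF assms] in \<open>auto simp: tube_map_def\<close>)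

lemma dir2_normal_pos:
  assumes "u \<in> M" "\<theta> \<noteq> 0"
  shows "dir2 l u (\<Sum>j\<in>UNIV. (\<theta> $ j) *\<^sub>R v j u) (\<Sum>j\<in>UNIV. (\<theta> $ j) *\<^sub>R v j u) > 0"
  using pos_def[OF assms(1)] assms(2) quadratic_form_affine[of \<theta> l u "\<lambda>j. v j u"]
  by (auto simp: hessian_eq[OF assms(1)] pos_definite_def)

text \<open>Compactness is applied to the base point and the unit normal direction jointly, through
  \<open>K\<close>; Taylor's formula along each normal ray then transfers the bounds on the second
  derivative to \<open>l\<close>, whence the factors 1/2.\<close>

lemma quadratic_growth_near:
  "\<exists>\<delta>>0. \<delta> < \<epsilon> \<and> (\<exists>c>0. \<exists>C>0. \<forall>u\<in>M. \<forall>t. norm t \<le> \<delta> \<longrightarrow>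
      c * (norm t)\<^sup>2 \<le> l (tube_map v t u) \<and> l (tube_map v t u) \<le> C * (norm t)\<^sup>2)"
proof -
  define K where "K = M \<times> sphere (0::real^'c) 1"
  define W where "W z = (\<Sum>j\<in>UNIV. (snd z $ j) *\<^sub>R v j (fst z))" for z :: "(real^'d) \<times> (real^'c)"
  \<comment> \<open>The second derivative of \<open>l\<close> along the normal line through
    \<open>fst z\<close>, at signed distance \<open>s\<close>.\<close>
  define Q where "Q = (\<lambda>(s::real, z). dir2 l (fst z + s *\<^sub>R W z) (W z) (W z))"
  have K: "compact K" unfolding K_def using compact_M by (intro compact_Times) auto
  have sW: "s *\<^sub>R W z = (\<Sum>j\<in>UNIV. ((s *\<^sub>R snd z) $ j) *\<^sub>R v j (fst z))" for s z
    by (simp add: W_def scaleR_sum_right)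
  have inU: "fst z + s *\<^sub>R W z \<in> U" if "z \<in> K" "\<bar>s\<bar> < \<epsilon>" for s z
    using tube_map_in_nbhd[of "fst z" "s *\<^sub>R snd z" \<epsilon>] that nbhd_U
    by (auto simp: K_def tube_map_def sW)
  have cW: "continuous_on (T \<times> K) (\<lambda>y. W (snd y))" for T :: "real set"
    unfolding W_def by (intro continuous_on_normal continuous_intros) (auto simp: K_def)
  have cQ: "continuous_on (cball 0 (\<epsilon> / 2) \<times> K) Q"
    unfolding Q_def split_beta'
    by (rule continuous_on_dir2[OF C2])
      (use \<epsilon>_pos in \<open>auto intro!: continuous_intros cW inU simp: dist_real_def\<close>)
  have Q0: "Q (0, z) > 0" if "z \<in> K" for z
  proof -
    have "norm (snd z) = 1" "fst z \<in> M" using that by (auto simp: K_def)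
    then have "snd z \<noteq> 0" by (metis norm_zero zero_neq_one)
    then show ?thesis using dir2_normal_pos[of "fst z" "snd z"] \<open>fst z \<in> M\<close> by (simp add: Q_def W_def)
  qed
  have "continuous_on K (\<lambda>z. Q (0, z))"
    by (rule continuous_on_compose2[OF cQ]) (use \<epsilon>_pos in \<open>auto intro!: continuous_intros\<close>)
  from compact_uniform_pos[OF K this Q0] obtain c where c: "c > 0" "\<And>z. z \<in> K \<Longrightarrow> Q (0, z) > c"
    by blast
  from compact_neighbourhood_gt[OF K _ cQ c(2)] \<epsilon>_pos obtain \<delta> where
    \<delta>: "\<delta> > 0" "\<delta> \<le> \<epsilon> / 2" "\<And>s z. norm s \<le> \<delta> \<Longrightarrow> z \<in> K \<Longrightarrow> Q (s, z) > c" by auto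
  have "compact (cball (0::real) (\<epsilon> / 2) \<times> K)" using K by (intro compact_Times) auto
  from compact_uniform_bound[OF this cQ] obtain C where C: "C > 0"
    "\<And>s z. \<bar>s\<bar> \<le> \<epsilon> / 2 \<Longrightarrow> z \<in> K \<Longrightarrow> \<bar>Q (s, z)\<bar> \<le> C" by (auto simp: dist_real_def)
  have "c / 2 * (norm t)\<^sup>2 \<le> l (tube_map v t u) \<and> l (tube_map v t u) \<le> C / 2 * (norm t)\<^sup>2"
    if u: "u \<in> M" and t: "norm t \<le> \<delta>" for u t
  proof (cases "t = 0")
    case True
    then show ?thesis using l_0[OF u] by (simp add: tube_map_def)
  next
    case False
    define z where "z = (u, t /\<^sub>R norm t)"
    have z: "z \<in> K" using False u by (simp add: z_def K_def)
    have *: "tube_map v t u = u + norm t *\<^sub>R W z"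
      using False by (simp add: tube_map_def sW z_def)
    have bd: "c \<le> dir2 l (u + r *\<^sub>R W z) (W z) (W z) \<and> dir2 l (u + r *\<^sub>R W z) (W z) (W z) \<le> C"
      if "\<bar>r\<bar> \<le> norm t" for r
      using \<delta>(3)[of r z] C(2)[of r z] that t \<delta>(2) z by (auto simp: Q_def z_def)
    have sub: "u + r *\<^sub>R W z \<in> U" if "\<bar>r\<bar> \<le> norm t" for r
      using inU[OF z, of r] that t \<delta>(2) \<epsilon>_pos by (simp add: z_def)
    show ?thesis
      using taylor2_bounds[OF open_U C2 l_nonneg l_0[OF u] norm_ge_zero[of t] sub bd] by (simp add: *)
  qed
  then show ?thesis using \<delta> c C \<epsilon>_pos
    by (intro exI[of _ \<delta>] conjI exI[of _ "c / 2"] exI[of _ "C / 2"]) auto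
qed

text \<open>For \<open>norm t\<close> above the radius of the local estimate, condition (T) gives a
  constant lower bound \<open>b\<close>; dividing by \<open>\<epsilon>\<^sup>2\<close> makes it a
  quadratic one, since \<open>norm t\<close> is below \<open>\<epsilon>\<close>.\<close>

lemma quadratic_growth:
  "\<exists>c>0. \<forall>u\<in>M. \<forall>t. norm t < \<epsilon> \<longrightarrow> c * (norm t)\<^sup>2 \<le> l (tube_map v t u)"
proof -
  obtain \<delta> c where \<delta>: "\<delta> > 0" "\<delta> < \<epsilon>" and c: "c > 0"
    "\<And>u t. u \<in> M \<Longrightarrow> norm t \<le> \<delta> \<Longrightarrow> c * (norm t)\<^sup>2 \<le> l (tube_map v t u)"
    using quadratic_growth_near by blast
  obtain b where b: "b > 0" "\<And>x. x \<in> tubular_nbhd M \<epsilon> - tubular_nbhd M \<delta> \<Longrightarrow> l x \<ge> b"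
    using sep[of \<delta>] \<delta> by auto
  have "min c (b / \<epsilon>\<^sup>2) * (norm t)\<^sup>2 \<le> l (tube_map v t u)" if u: "u \<in> M" and t: "norm t < \<epsilon>" for u t
  proof (cases "norm t \<le> \<delta>")
    case True
    have "min c (b / \<epsilon>\<^sup>2) * (norm t)\<^sup>2 \<le> c * (norm t)\<^sup>2" by (intro mult_right_mono) auto
    then show ?thesis using c(2)[OF u True] by simp
  next
    case False
    have "min c (b / \<epsilon>\<^sup>2) * (norm t)\<^sup>2 \<le> b / \<epsilon>\<^sup>2 * \<epsilon>\<^sup>2"
      using t b \<epsilon>_pos by (intro mult_mono power_mono) auto
    also have "\<dots> = b" using \<epsilon>_pos by simp
    also have "b \<le> l (tube_map v t u)"
      using norm_less_of_in_nbhd[OF u t, of \<delta>] tube_map_in_nbhd[OF u t] False \<delta> by (intro b) auto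
    finally show ?thesis .
  qed
  then show ?thesis using c b \<epsilon>_pos by (intro exI[of _ "min c (b / \<epsilon>\<^sup>2)"]) auto
qed

text \<open>By \<open>hessian_eq\<close> the determinant involves only ambient second derivatives
  evaluated on the frame, whose dependence on \<open>u\<close> is visibly continuous.\<close>

lemma continuous_on_laplace_weight: "continuous_on M (laplace_weight \<pi>0 l v)"
proof -
  have "continuous_on M (\<lambda>u. dir2 l u (v b u) (v a u))" for a b
    using nbhd_U tube_map_in_nbhd[of _ 0 \<epsilon>] \<epsilon>_pos
    by (intro continuous_on_dir2[OF C2] continuous_on_frame continuous_intros) (auto simp: tube_map_def)
  then have "continuous_on M (\<lambda>u. det (\<chi> a b. dir2 l u (v b u) (v a u)))"
    unfolding det_def by (auto intro!: continuous_intros)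
  then have d: "continuous_on M (\<lambda>u. det (hessian (\<lambda>t. l (tube_map v t u)) 0))"
    by (rule continuous_on_eq) (simp add: hessian_eq)
  show ?thesis
    unfolding laplace_weight_def tube_map_def[of v 0] using pos_def
    by (auto intro!: continuous_intros d det_nonzero_if_pos_definite continuous_on_subset[OF cont_\<pi>0])
qed

lemma laplace_weight_pos: "u \<in> M \<Longrightarrow> laplace_weight \<pi>0 l v u > 0"
  using det_nonzero_if_pos_definite[OF pos_def] \<pi>0_pos by (simp add: laplace_weight_def)

lemma laplace_weight_integrable: "integrable \<nu> (laplace_weight \<pi>0 l v)"
proof -
  interpret finite_measure \<nu> by (rule finite_measure_\<nu>)
  obtain C where "\<And>u. u \<in> M \<Longrightarrow> \<bar>laplace_weight \<pi>0 l v u\<bar> \<le> C"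
    using compact_uniform_bound[OF compact_M continuous_on_laplace_weight] by blast
  then show ?thesis
    by (intro integrable_const_bound[where B = C] continuous_on_imp_measurable_\<nu> continuous_on_laplace_weight)
      (auto simp: space_\<nu>)
qed

lemma integral_laplace_weight_nonneg: "(LINT u|\<nu>. laplace_weight \<pi>0 l v u) \<ge> 0"
  by (intro integral_nonneg_AE AE_I2) (auto simp: space_\<nu> less_imp_le laplace_weight_pos)

lemma integral_laplace_weight_pos:
  assumes "M \<noteq> {}"
  shows "(LINT u|\<nu>. laplace_weight \<pi>0 l v u) > 0"
proof -
  interpret finite_measure \<nu> by (rule finite_measure_\<nu>)
  obtain c where c: "c > 0" "\<And>u. u \<in> M \<Longrightarrow> laplace_weight \<pi>0 l v u > c"
    using compact_uniform_pos[OF compact_M continuous_on_laplace_weight laplace_weight_pos] by blast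
  have "measure \<nu> M > 0"
    using emeasure_\<nu>_pos[OF assms] emeasure_\<nu>_finite by (simp add: measure_def enn2real_positive_iff)
  then have "0 < c * measure \<nu> M" using c(1) by simp
  also have "c * measure \<nu> M = (LINT u|\<nu>. c)" by (simp add: space_\<nu>)
  also have "\<dots> \<le> (LINT u|\<nu>. laplace_weight \<pi>0 l v u)"
    using c by (intro integral_mono_AE laplace_weight_integrable AE_I2) (auto simp: space_\<nu> less_imp_le)
  finally show ?thesis .
qed

lemma \<pi>0_bounds: "\<exists>a>0. \<exists>B>0. \<forall>x\<in>tubular_nbhd M \<epsilon>. a \<le> \<pi>0 x \<and> \<pi>0 x \<le> B"
proof -
  have K: "compact (closure (tubular_nbhd M \<epsilon>))" using bounded_nbhd by simp
  have c: "continuous_on (closure (tubular_nbhd M \<epsilon>)) \<pi>0" using cont_\<pi>0 by (rule continuous_on_subset) simp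
  from compact_uniform_pos[OF K c \<pi>0_pos] compact_uniform_bound[OF K c] show ?thesis
    using closure_subset[of "tubular_nbhd M \<epsilon>"] by (meson abs_le_D1 less_imp_le subsetD)
qed

text \<open>On a normal fibre the displacement is \<open>norm t\<close>, so the integrand is at most
  a Gaussian moment integrand times the bounds \<open>B\<close> on the prior density and
  \<open>H\<close> on Weyl's density; integration over \<open>M\<close> adds its volume
  \<open>V\<close>. \<open>P\<close> has to agree with \<open>foot\<close> on this tube only, so
  that one measurable map can serve all tubes.\<close>

lemma nn_integral_transport:
  assumes P[measurable]: "P \<in> borel_measurable borel" and foot: "\<And>x. x \<in> tubular_nbhd M \<epsilon> \<Longrightarrow> P x = foot x"
  shows "\<exists>K\<ge>0. \<forall>n\<ge>1. (\<integral>\<^sup>+ x\<in>tubular_nbhd M \<epsilon>. ennreal (norm (x - P x) ^ p * (exp (- (real n * l x)) * \<pi>0 x)) \<partial>lborel)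
     \<le> ennreal (K * (1 / sqrt (real n)) ^ (p + CARD('c)))"
proof -
  obtain c where c: "c > 0" "\<And>u t. u \<in> M \<Longrightarrow> norm t < \<epsilon> \<Longrightarrow> c * (norm t)\<^sup>2 \<le> l (tube_map v t u)"
    using quadratic_growth by blast
  obtain B where B: "B > 0" "\<And>x. x \<in> tubular_nbhd M \<epsilon> \<Longrightarrow> \<pi>0 x \<le> B" using \<pi>0_bounds by blast
  obtain H where H: "H > 0" "\<And>t u. norm t \<le> \<epsilon> \<Longrightarrow> u \<in> M \<Longrightarrow> \<bar>weyl_h G t u\<bar> \<le> H"
    using weyl_h_bound by blast
  obtain K where K: "K \<ge> 0" "\<And>n. n \<ge> 1 \<Longrightarrow> (\<integral>\<^sup>+ t. ennreal (norm t ^ p * exp (- (real n * (c * (norm t)\<^sup>2)))) \<partial>(lborel :: (real^'c) measure))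
    \<le> ennreal (K * (1 / sqrt (real n)) ^ (p + CARD('c)))"
    using nn_integral_gaussian_moment[OF c(1), of p, where 'a = "real^'c"] by auto
  define V where "V = measure \<nu> M"
  have V: "emeasure \<nu> M = ennreal V"
    using emeasure_\<nu>_finite by (simp add: V_def measure_def)
  show ?thesis
  proof (intro exI[of _ "B * H * K * V"] conjI allI impI)
    show "B * H * K * V \<ge> 0" using B H K by (simp add: V_def)
    fix n :: nat assume n: "n \<ge> 1"
    let ?R = "(1 / sqrt (real n)) ^ (p + CARD('c))"
    let ?f = "\<lambda>x. ennreal (norm (x - P x) ^ p * (exp (- (real n * l x)) * \<pi>0 x))"
    have "(\<integral>\<^sup>+ x\<in>tubular_nbhd M \<epsilon>. ?f x \<partial>lborel) =
        (\<integral>\<^sup>+ u. (\<integral>\<^sup>+ t\<in>ball 0 \<epsilon>. ?f (tube_map v t u) * ennreal (weyl_h G t u) \<partial>lborel) \<partial>\<nu>)"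
      by (rule weyl_formula) measurable
    also have "\<dots> \<le> (\<integral>\<^sup>+ u. ennreal (B * H) * ennreal (K * ?R) \<partial>\<nu>)"
    proof (rule nn_integral_mono)
      fix u assume "u \<in> space \<nu>"
      then have u: "u \<in> M" by (simp add: space_\<nu>)
      have "(\<integral>\<^sup>+ t\<in>ball 0 \<epsilon>. ?f (tube_map v t u) * ennreal (weyl_h G t u) \<partial>lborel)
        \<le> (\<integral>\<^sup>+ t. ennreal (B * H) * ennreal (norm t ^ p * exp (- (real n * (c * (norm t)\<^sup>2)))) \<partial>(lborel :: (real^'c) measure))"
      proof (rule nn_integral_mono)
        fix t :: "real^'c"
        have "?f (tube_map v t u) * ennreal (weyl_h G t u) \<le>
            ennreal (B * H) * ennreal (norm t ^ p * exp (- (real n * (c * (norm t)\<^sup>2))))" if t: "norm t < \<epsilon>"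
        proof -
          have "norm (tube_map v t u - P (tube_map v t u)) = norm t"
            using tube_map_in_nbhd[OF u t] by (simp add: foot foot_tube_map[OF u t] dist_tube_map[OF u])
          moreover have "exp (- (real n * l (tube_map v t u))) \<le> exp (- (real n * (c * (norm t)\<^sup>2)))"
            using c(2)[OF u t] by (simp add: mult_left_mono)
          ultimately have "norm (tube_map v t u - P (tube_map v t u)) ^ p *
              (exp (- (real n * l (tube_map v t u))) * \<pi>0 (tube_map v t u)) * weyl_h G t u
            \<le> norm t ^ p * (exp (- (real n * (c * (norm t)\<^sup>2))) * B) * H"
            using B(2)[OF tube_map_in_nbhd[OF u t]] H(2)[of t u] H(1) B(1) t u weyl_h_nonneg[OF u t] \<pi>0_pos[THEN less_imp_le]
            by (intro mult_mono) (auto intro!: mult_nonneg_nonneg)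
          then show ?thesis using B(1) H(1) weyl_h_nonneg[OF u t] \<pi>0_pos[THEN less_imp_le]
            by (auto simp: ennreal_mult[symmetric] mult_ac intro!: ennreal_leI)
        qed
        then show "?f (tube_map v t u) * ennreal (weyl_h G t u) * indicator (ball 0 \<epsilon>) t \<le>
          ennreal (B * H) * ennreal (norm t ^ p * exp (- (real n * (c * (norm t)\<^sup>2))))"
          by (auto simp: indicator_def)
      qed
      also have "\<dots> = ennreal (B * H) * (\<integral>\<^sup>+ t. ennreal (norm t ^ p * exp (- (real n * (c * (norm t)\<^sup>2)))) \<partial>(lborel :: (real^'c) measure))"
        by (rule nn_integral_cmult) measurable
      also have "\<dots> \<le> ennreal (B * H) * ennreal (K * ?R)"
        by (intro mult_left_mono K n) auto
      finally show "(\<integral>\<^sup>+ t\<in>ball 0 \<epsilon>. ?f (tube_map v t u) * ennreal (weyl_h G t u) \<partial>lborel) \<le> \<dots>" .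
    qed
    also have "\<dots> = ennreal (B * H * K * V * ?R)"
      using B H K by (simp add: space_\<nu> V ennreal_mult[symmetric] V_def mult_ac)
    finally show "(\<integral>\<^sup>+ x\<in>tubular_nbhd M \<epsilon>. ?f x \<partial>lborel) \<le> ennreal (B * H * K * V * ?R)" .
  qed
qed

text \<open>On the normal ball of radius \<open>\<delta> * R\<close>, with \<open>R\<close> the
  inverse square root of \<open>n\<close>, the exponent \<open>n * l\<close> is at most
  \<open>C * \<delta>\<^sup>2\<close>, so the integrand has a lower bound free of \<open>n\<close>,
  and the volume of the ball supplies the power of \<open>R\<close>. As \<open>R \<le> 1\<close>,
  the ball stays where the local bounds hold, for every \<open>n \<ge> 1\<close>.\<close>

lemma nn_integral_gibbs_lower:
  assumes "M \<noteq> {}"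
  shows "\<exists>a>0. \<forall>n\<ge>1. ennreal (a * (1 / sqrt (real n)) ^ CARD('c)) \<le>
    (\<integral>\<^sup>+ x\<in>tubular_nbhd M \<epsilon>. ennreal (exp (- (real n * l x)) * \<pi>0 x) \<partial>lborel)"
proof -
  obtain \<delta>1 C where \<delta>1: "\<delta>1 > 0" "\<delta>1 < \<epsilon>" and C: "C > 0"
    "\<And>u t. u \<in> M \<Longrightarrow> norm t \<le> \<delta>1 \<Longrightarrow> l (tube_map v t u) \<le> C * (norm t)\<^sup>2"
    using quadratic_growth_near by blast
  obtain \<delta>2 where \<delta>2: "\<delta>2 > 0" and h: "\<And>t u. norm t \<le> \<delta>2 \<Longrightarrow> u \<in> M \<Longrightarrow> weyl_h G t u > 1 / 2"
    using weyl_h_lower by blast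
  obtain b where b: "b > 0" "\<And>x. x \<in> tubular_nbhd M \<epsilon> \<Longrightarrow> b \<le> \<pi>0 x" using \<pi>0_bounds by blast
  define \<delta> where "\<delta> = min \<delta>1 \<delta>2"
  have \<delta>: "\<delta> > 0" "\<delta> \<le> \<delta>1" "\<delta> \<le> \<delta>2" using \<delta>1 \<delta>2 by (auto simp: \<delta>_def)
  define V where "V = measure \<nu> M"
  have V: "emeasure \<nu> M = ennreal V" "V > 0"
    using emeasure_\<nu>_finite emeasure_\<nu>_pos[OF assms] by (simp_all add: V_def measure_def enn2real_positive_iff)
  define w where "w = unit_ball_vol (real CARD('c)) * \<delta> ^ CARD('c)"
  have w: "w > 0" using \<delta> unit_ball_vol_pos[of "real CARD('c)"] by (simp add: w_def)
  define q where "q = exp (- (C * \<delta>\<^sup>2)) * b * (1 / 2)"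
  have q: "q > 0" using b by (simp add: q_def)
  show ?thesis
  proof (intro exI[of _ "q * w * V"] conjI allI impI)
    show "q * w * V > 0" using V w q by simp
    fix n :: nat assume n: "n \<ge> 1"
    define R where "R = 1 / sqrt (real n)"
    have R: "R > 0" "R \<le> 1" "real n * R\<^sup>2 = 1" using n by (auto simp: R_def power_divide)
    let ?f = "\<lambda>x. ennreal (exp (- (real n * l x)) * \<pi>0 x)"
    have "ennreal (q * w * V * R ^ CARD('c)) = (\<integral>\<^sup>+ u. ennreal q * emeasure lborel (ball (0::real^'c) (\<delta> * R)) \<partial>\<nu>)"
      using V w q R \<delta> by (simp add: space_\<nu> emeasure_ball w_def ennreal_mult[symmetric] power_mult_distrib mult_ac)
    also have "\<dots> \<le> (\<integral>\<^sup>+ u. (\<integral>\<^sup>+ t\<in>ball 0 \<epsilon>. ?f (tube_map v t u) * ennreal (weyl_h G t u) \<partial>lborel) \<partial>\<nu>)"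
    proof (rule nn_integral_mono)
      fix u assume "u \<in> space \<nu>"
      then have u: "u \<in> M" by (simp add: space_\<nu>)
      have "ennreal q * emeasure lborel (ball (0::real^'c) (\<delta> * R)) =
          (\<integral>\<^sup>+ t. ennreal q * indicator (ball (0::real^'c) (\<delta> * R)) t \<partial>lborel)"
        by (simp add: nn_integral_cmult_indicator)
      also have "\<dots> \<le> (\<integral>\<^sup>+ t\<in>ball 0 \<epsilon>. ?f (tube_map v t u) * ennreal (weyl_h G t u) \<partial>lborel)"
      proof (rule nn_integral_mono)
        fix t :: "real^'c"
        have "norm t < \<epsilon> \<and> ennreal q \<le> ?f (tube_map v t u) * ennreal (weyl_h G t u)" if t: "norm t < \<delta> * R"
        proof -
          have tR: "norm t \<le> \<delta> * R" using t by simp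
          also have "\<dots> \<le> \<delta>" using mult_left_mono[of R 1 \<delta>] R \<delta> by simp
          finally have t': "norm t \<le> \<delta>1" "norm t \<le> \<delta>2" "norm t < \<epsilon>" using \<delta> \<delta>1 by auto
          have "real n * l (tube_map v t u) \<le> real n * (C * (\<delta> * R)\<^sup>2)"
            using C(2)[OF u t'(1)] C(1) tR by (intro mult_left_mono order_trans[OF C(2)[OF u t'(1)]] power_mono) auto
          also have "\<dots> = C * \<delta>\<^sup>2 * (real n * R\<^sup>2)" by (simp add: power_mult_distrib)
          finally have "exp (- (C * \<delta>\<^sup>2)) \<le> exp (- (real n * l (tube_map v t u)))" using R(3) by simp
          then have "q \<le> exp (- (real n * l (tube_map v t u))) * \<pi>0 (tube_map v t u) * weyl_h G t u"
            unfolding q_def using b(1) b(2)[OF tube_map_in_nbhd[OF u t'(3)]] h[OF t'(2) u] \<pi>0_pos[THEN less_imp_le]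
            by (intro mult_mono) auto
          then show ?thesis using t'(3) weyl_h_nonneg[OF u t'(3)] \<pi>0_pos[THEN less_imp_le]
            by (auto simp: ennreal_mult[symmetric] intro!: ennreal_leI)
        qed
        then show "ennreal q * indicator (ball 0 (\<delta> * R)) t \<le> ?f (tube_map v t u) * ennreal (weyl_h G t u) * indicator (ball 0 \<epsilon>) t"
          by (auto simp: indicator_def)
      qed
      finally show "ennreal q * emeasure lborel (ball (0::real^'c) (\<delta> * R)) \<le> \<dots>" .
    qed
    also have "\<dots> = (\<integral>\<^sup>+ x\<in>tubular_nbhd M \<epsilon>. ?f x \<partial>lborel)"
      by (rule weyl_formula[symmetric]) measurable
    finally show "ennreal (q * w * V * (1 / sqrt (real n)) ^ CARD('c)) \<le> (\<integral>\<^sup>+ x\<in>tubular_nbhd M \<epsilon>. ?f x \<partial>lborel)"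
      by (simp add: R_def)
  qed
qed

text \<open>\<open>zeta\<close> is a Bochner integral, which would be 0 by default for a
  non-integrable function. Boundedness on the ball rules this out and links it to the nonnegative
  integrals of Weyl's formula.\<close>

lemma nn_integral_zeta:
  assumes u: "u \<in> M"
  shows "(\<integral>\<^sup>+ t\<in>ball 0 \<epsilon>. ennreal (exp (- (real n * l (tube_map v t u))) * \<pi>0 (tube_map v t u)) * ennreal (weyl_h G t u) \<partial>lborel)
    = ennreal (zeta \<pi>0 l v G \<epsilon> n u)"
proof -
  obtain B where B: "B > 0" "\<And>x. x \<in> tubular_nbhd M \<epsilon> \<Longrightarrow> \<pi>0 x \<le> B" using \<pi>0_bounds by blast
  obtain H where H: "H > 0" "\<And>t u. norm t \<le> \<epsilon> \<Longrightarrow> u \<in> M \<Longrightarrow> \<bar>weyl_h G t u\<bar> \<le> H"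
    using weyl_h_bound by blast
  let ?g = "\<lambda>t. exp (- (real n * l (tube_map v t u))) * \<pi>0 (tube_map v t u) * weyl_h G t u"
  have [measurable]: "(\<lambda>t. tube_map v t u) \<in> borel_measurable borel" "(\<lambda>t. weyl_h G t u) \<in> borel_measurable borel"
    using u unfolding tube_map_def
    by (auto intro!: borel_measurable_continuous_onI continuous_intros continuous_on_weyl_h)
  have "integrable lborel (\<lambda>t. indicator (ball 0 \<epsilon>) t *\<^sub>R ?g t)"
  proof (rule integrableI_bounded_set_indicator[where B = "1 * B * H"])
    show "emeasure lborel (ball (0::real^'c) \<epsilon>) < \<infinity>" using emeasure_bounded_finite[OF bounded_ball] by simp
    have "\<bar>?g t\<bar> \<le> 1 * B * H" if t: "norm t < \<epsilon>" for t
    proof -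
      have "\<bar>?g t\<bar> = exp (- (real n * l (tube_map v t u))) * \<pi>0 (tube_map v t u) * \<bar>weyl_h G t u\<bar>"
        using \<pi>0_pos[of "tube_map v t u"] by (simp add: abs_mult)
      also have "\<dots> \<le> 1 * B * H"
        using B(1) H(1) B(2)[OF tube_map_in_nbhd[OF u t]] H(2)[of t u] t u \<pi>0_pos[THEN less_imp_le] l_nonneg
        by (intro mult_mono) auto
      finally show ?thesis .
    qed
    then show "AE t in lborel. t \<in> ball 0 \<epsilon> \<longrightarrow> norm (?g t) \<le> 1 * B * H" by (intro AE_I2) auto
  qed (auto intro!: borel_measurable_times)
  moreover have "AE t in lborel. 0 \<le> indicator (ball 0 \<epsilon>) t *\<^sub>R ?g t"
    using weyl_h_nonneg[OF u] \<pi>0_pos[THEN less_imp_le] by (intro AE_I2) (auto simp: indicator_def)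
  ultimately have "(\<integral>\<^sup>+ t. ennreal (indicator (ball 0 \<epsilon>) t *\<^sub>R ?g t) \<partial>lborel) = ennreal (LINT t|lborel. indicator (ball 0 \<epsilon>) t *\<^sub>R ?g t)"
    by (rule nn_integral_eq_integral)
  moreover have "(\<integral>\<^sup>+ t. ennreal (indicator (ball 0 \<epsilon>) t *\<^sub>R ?g t) \<partial>lborel) =
      (\<integral>\<^sup>+ t\<in>ball 0 \<epsilon>. ennreal (exp (- (real n * l (tube_map v t u))) * \<pi>0 (tube_map v t u)) * ennreal (weyl_h G t u) \<partial>lborel)"
    using weyl_h_nonneg[OF u] \<pi>0_pos[THEN less_imp_le]
    by (intro nn_integral_cong) (auto simp: indicator_def ennreal_mult[symmetric])
  ultimately show ?thesis by (simp add: zeta_def set_lebesgue_integral_def)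
qed

text \<open>\<open>P\<close> is constant on each normal fibre, so the indicator leaves the inner
  integral of Weyl's formula. What remains is the volume density of the image of the Gibbs measure,
  the quantity that the domination hypothesis compares with the limit density.\<close>

lemma marginal_foot:
  assumes P[measurable]: "P \<in> borel_measurable borel" and foot: "\<And>x. x \<in> tubular_nbhd M \<epsilon> \<Longrightarrow> P x = foot x"
    and A[measurable]: "A \<in> sets borel" and Z: "Z > 0"
  shows "(\<integral>\<^sup>+ x\<in>tubular_nbhd M \<epsilon>. ennreal (exp (- (real n * l x)) * \<pi>0 x / Z) * indicator A (P x) \<partial>lborel) =
    (\<integral>\<^sup>+ u. ennreal (inverse Z * zeta \<pi>0 l v G \<epsilon> n u) * indicator A u \<partial>\<nu>)"
proof -
  have "(\<integral>\<^sup>+ x\<in>tubular_nbhd M \<epsilon>. ennreal (exp (- (real n * l x)) * \<pi>0 x / Z) * indicator A (P x) \<partial>lborel) =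
     (\<integral>\<^sup>+ u. (\<integral>\<^sup>+ t\<in>ball 0 \<epsilon>. ennreal (exp (- (real n * l (tube_map v t u))) * \<pi>0 (tube_map v t u) / Z)
        * indicator A (P (tube_map v t u)) * ennreal (weyl_h G t u) \<partial>lborel) \<partial>\<nu>)"
    by (rule weyl_formula) measurable
  also have "\<dots> = (\<integral>\<^sup>+ u. ennreal (inverse Z * zeta \<pi>0 l v G \<epsilon> n u) * indicator A u \<partial>\<nu>)"
  proof (rule nn_integral_cong)
    fix u assume "u \<in> space \<nu>"
    then have u: "u \<in> M" by (simp add: space_\<nu>)
    have [measurable]: "(\<lambda>t. tube_map v t u) \<in> borel_measurable borel" "(\<lambda>t. weyl_h G t u) \<in> borel_measurable borel"
      using u unfolding tube_map_def
      by (auto intro!: borel_measurable_continuous_onI continuous_intros continuous_on_weyl_h)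
    have "(\<integral>\<^sup>+ t\<in>ball 0 \<epsilon>. ennreal (exp (- (real n * l (tube_map v t u))) * \<pi>0 (tube_map v t u) / Z)
        * indicator A (P (tube_map v t u)) * ennreal (weyl_h G t u) \<partial>lborel) =
      (\<integral>\<^sup>+ t. (ennreal (inverse Z) * indicator A u) * (ennreal (exp (- (real n * l (tube_map v t u))) * \<pi>0 (tube_map v t u))
        * ennreal (weyl_h G t u) * indicator (ball 0 \<epsilon>) t) \<partial>lborel)"
    proof (rule nn_integral_cong)
      fix t :: "real^'c"
      have "P (tube_map v t u) = u" if "norm t < \<epsilon>"
        using foot[OF tube_map_in_nbhd[OF u that]] foot_tube_map[OF u that] by simp
      then show "ennreal (exp (- (real n * l (tube_map v t u))) * \<pi>0 (tube_map v t u) / Z)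
        * indicator A (P (tube_map v t u)) * ennreal (weyl_h G t u) * indicator (ball 0 \<epsilon>) t =
        (ennreal (inverse Z) * indicator A u) * (ennreal (exp (- (real n * l (tube_map v t u))) * \<pi>0 (tube_map v t u))
        * ennreal (weyl_h G t u) * indicator (ball 0 \<epsilon>) t)"
        using Z by (auto simp: indicator_def ennreal_mult' divide_inverse mult.commute[of _ "inverse Z"] mult.assoc)
    qed
    also have "\<dots> = (ennreal (inverse Z) * indicator A u) * ennreal (zeta \<pi>0 l v G \<epsilon> n u)"
      unfolding nn_integral_zeta[OF u, symmetric]
    proof (rule nn_integral_cmult)
      have [measurable]: "ball (0::real^'c) \<epsilon> \<in> sets borel" by simp
      show "(\<lambda>t. ennreal (exp (- (real n * l (tube_map v t u))) * \<pi>0 (tube_map v t u))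
        * ennreal (weyl_h G t u) * indicator (ball 0 \<epsilon>) t) \<in> borel_measurable lborel" by measurable
    qed
    also have "\<dots> = ennreal (inverse Z * zeta \<pi>0 l v G \<epsilon> n u) * indicator A u"
      using Z by (simp add: ennreal_mult' mult_ac)
    finally show "(\<integral>\<^sup>+ t\<in>ball 0 \<epsilon>. ennreal (exp (- (real n * l (tube_map v t u))) * \<pi>0 (tube_map v t u) / Z)
        * indicator A (P (tube_map v t u)) * ennreal (weyl_h G t u) \<partial>lborel) = \<dots>" .
  qed
  finally show ?thesis .
qed

end

section \<open>The limit measure\<close>

text \<open>\<open>measure_of\<close> takes the prescribed values only if they form a measure, and
  is null otherwise. Countable additivity is inherited from each \<open>vol i\<close>, since
  closedness of the sets involved makes \<open>A \<inter> M i\<close> measurable there.\<close>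

lemma emeasure_total_volume:
  fixes M :: "nat \<Rightarrow> (real^'d) set"
  assumes M: "\<And>i. i \<in> {1..m} \<Longrightarrow> compact (M i)" "zero_set l = (\<Union>i\<in>{1..m}. M i)"
    and vol: "\<And>i. i \<in> {1..m} \<Longrightarrow> sets (vol i) = sets (restrict_space borel (M i))"
    and A: "A \<in> sets (restrict_space borel (zero_set l))"
  shows "emeasure (total_volume l m M vol) A = (\<Sum>i=1..m. emeasure (vol i) (A \<inter> M i))"
  unfolding total_volume_def
proof (rule emeasure_measure_of_sigma)
  let ?S = "restrict_space borel (zero_set l) :: (real^'d) measure"
  show "sigma_algebra (zero_set l) (sets ?S)"
    using sets.sigma_algebra_axioms[of ?S] by (simp add: space_restrict_space)
  show "positive (sets ?S) (\<lambda>A. \<Sum>i=1..m. emeasure (vol i) (A \<inter> M i))"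
    by (simp add: positive_def)
  have clo: "closed (zero_set l)" unfolding M(2) using M(1) by (intro closed_UN) (auto intro: compact_imp_closed)
  show "countably_additive (sets ?S) (\<lambda>A. \<Sum>i=1..m. emeasure (vol i) (A \<inter> M i))"
    unfolding countably_additive_def
  proof safe
    fix F :: "nat \<Rightarrow> (real^'d) set" assume F: "range F \<subseteq> sets ?S" "disjoint_family F"
    have "(\<Sum>n. emeasure (vol i) (F n \<inter> M i)) = emeasure (vol i) ((\<Union>n. F n) \<inter> M i)" if i: "i \<in> {1..m}" for i
    proof -
      have "F n \<inter> M i \<in> sets (vol i)" for n
      proof -
        have "F n \<in> sets ?S" using F(1) by auto
        then show ?thesis
          using clo compact_imp_closed[OF M(1)[OF i]] i by (auto simp: vol sets_restrict_space_iff borel_closed)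
      qed
      then have "(\<Sum>n. emeasure (vol i) (F n \<inter> M i)) = emeasure (vol i) (\<Union>n. F n \<inter> M i)"
        using F(2) by (intro suminf_emeasure) (auto simp: disjoint_family_on_def)
      then show ?thesis by simp
    qed
    then show "(\<Sum>n. \<Sum>i=1..m. emeasure (vol i) (F n \<inter> M i)) = (\<Sum>i=1..m. emeasure (vol i) (\<Union> (range F) \<inter> M i))"
      by (subst suminf_sum) auto
  qed
qed fact

lemma sets_total_volume: "sets (total_volume l m M vol) = sets (restrict_space borel (zero_set l))"
  using sets.sigma_sets_eq[of "restrict_space borel (zero_set l)"] sets.space_closed[of "restrict_space borel (zero_set l)"]
  by (simp add: total_volume_def space_restrict_space sets_measure_of)

text \<open>\<open>total_volume\<close> is given by its values on sets, so the sum formula is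
  carried from indicators to measurable functions by induction.\<close>

lemma nn_integral_total_volume:
  fixes M :: "nat \<Rightarrow> (real^'d) set"
  assumes M: "\<And>i. i \<in> {1..m} \<Longrightarrow> compact (M i)" "zero_set l = (\<Union>i\<in>{1..m}. M i)"
    and vol: "\<And>i. i \<in> {1..m} \<Longrightarrow> sets (vol i) = sets (restrict_space borel (M i))"
    and f: "f \<in> borel_measurable borel"
  shows "(\<integral>\<^sup>+ u. f u \<partial>total_volume l m M vol) = (\<Sum>i=1..m. \<integral>\<^sup>+ u. f u \<partial>vol i)"
proof -
  let ?T = "total_volume l m M vol"
  note sT = sets_total_volume[of l m M vol]
  have T: "g \<in> borel_measurable ?T" if "g \<in> borel_measurable borel" for g :: "real^'d \<Rightarrow> ennreal"
    unfolding measurable_cong_sets[OF sT refl] using that by (rule measurable_restrict_space1)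
  have V: "g \<in> borel_measurable (vol i)" if "i \<in> {1..m}" "g \<in> borel_measurable borel" for g :: "real^'d \<Rightarrow> ennreal" and i
    unfolding measurable_cong_sets[OF vol[OF that(1)] refl] using that(2) by (rule measurable_restrict_space1)
  have spT: "space ?T = zero_set l"
    using sets_eq_imp_space_eq[OF sT] by (simp add: space_restrict_space)
  have spV: "space (vol i) = M i" if "i \<in> {1..m}" for i
    using sets_eq_imp_space_eq[OF vol[OF that]] by (simp add: space_restrict_space)
  have clo: "closed (zero_set l)" unfolding M(2) using M(1) by (intro closed_UN) (auto intro: compact_imp_closed)
  show ?thesis using f
  proof (induction f rule: borel_measurable_induct)
    case (cong f g)
    then have "f = g" by auto
    then show ?case using cong by simp
  next
    case (set A)
    have "(\<integral>\<^sup>+ u. indicator A u \<partial>?T) = (\<integral>\<^sup>+ u. indicator (A \<inter> zero_set l) u \<partial>?T)"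
      by (rule nn_integral_cong) (auto simp: spT indicator_def)
    also have "\<dots> = (\<Sum>i=1..m. emeasure (vol i) (A \<inter> zero_set l \<inter> M i))"
    proof -
      have "A \<inter> zero_set l \<in> sets (restrict_space borel (zero_set l))"
        using set clo by (auto simp: sets_restrict_space_iff borel_closed)
      then show ?thesis
        using emeasure_total_volume[OF M vol] by (subst nn_integral_indicator) (simp_all add: sT)
    qed
    also have "\<dots> = (\<Sum>i=1..m. \<integral>\<^sup>+ u. indicator A u \<partial>vol i)"
    proof (rule sum.cong[OF refl])
      fix i assume i: "i \<in> {1..m}"
      have "A \<inter> zero_set l \<inter> M i \<in> sets (vol i)"
        using set clo compact_imp_closed[OF M(1)[OF i]] by (auto simp: vol[OF i] sets_restrict_space_iff borel_closed)
      then have "emeasure (vol i) (A \<inter> zero_set l \<inter> M i) = (\<integral>\<^sup>+ u. indicator (A \<inter> zero_set l \<inter> M i) u \<partial>vol i)"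
        by simp
      also have "\<dots> = (\<integral>\<^sup>+ u. indicator A u \<partial>vol i)"
        using i by (intro nn_integral_cong) (auto simp: spV indicator_def M(2))
      finally show "emeasure (vol i) (A \<inter> zero_set l \<inter> M i) = (\<integral>\<^sup>+ u. indicator A u \<partial>vol i)" .
    qed
    finally show ?case .
  next
    case (mult f c)
    then show ?case by (simp add: nn_integral_cmult T V sum_distrib_left)
  next
    case (add f g)
    then show ?case by (simp add: nn_integral_add T V sum.distrib)
  next
    case (seq F)
    have inc: "incseq (\<lambda>n. \<integral>\<^sup>+ u. F n u \<partial>N)" for N
      using \<open>incseq F\<close> by (auto simp: incseq_def le_fun_def intro!: nn_integral_mono)
    have lim: "(\<lambda>n. \<integral>\<^sup>+ u. F n u \<partial>N) \<longlonglongrightarrow> (\<integral>\<^sup>+ u. (SUP n. F n) u \<partial>N)"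
      if "\<And>n. F n \<in> borel_measurable N" for N
      using LIMSEQ_SUP[OF inc[of N]]
      unfolding nn_integral_monotone_convergence_SUP[OF \<open>incseq F\<close> that, symmetric] SUP_apply .
    have "(\<lambda>n. \<integral>\<^sup>+ u. F n u \<partial>?T) \<longlonglongrightarrow> (\<integral>\<^sup>+ u. (SUP n. F n) u \<partial>?T)"
      by (intro lim T seq.hyps(1))
    moreover have "(\<lambda>n. \<Sum>i=1..m. \<integral>\<^sup>+ u. F n u \<partial>vol i) \<longlonglongrightarrow> (\<Sum>i=1..m. \<integral>\<^sup>+ u. (SUP n. F n) u \<partial>vol i)"
      by (intro tendsto_sum lim V seq.hyps(1))
    then have "(\<lambda>n. \<integral>\<^sup>+ u. F n u \<partial>?T) \<longlonglongrightarrow> (\<Sum>i=1..m. \<integral>\<^sup>+ u. (SUP n. F n) u \<partial>vol i)"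
      unfolding seq.IH .
    ultimately show ?case by (rule LIMSEQ_unique)
  qed
qed

lemma emeasure_limit_measure:
  fixes M :: "nat \<Rightarrow> (real^'d) set"
  assumes M: "\<And>i. i \<in> {1..m} \<Longrightarrow> compact (M i)" "zero_set l = (\<Union>i\<in>{1..m}. M i)"
    and vol: "\<And>i. i \<in> {1..m} \<Longrightarrow> sets (vol i) = sets (restrict_space borel (M i))"
    and \<phi>: "limit_density \<pi>0 l m M v vol \<in> borel_measurable borel"
    and A: "A \<in> sets borel"
  shows "emeasure (limit_measure \<pi>0 l m M v vol) A =
    (\<Sum>i=1..m. \<integral>\<^sup>+ u. ennreal (limit_density \<pi>0 l m M v vol u) * indicator A u \<partial>vol i)"
proof -
  let ?T = "total_volume l m M vol"
  let ?\<phi> = "limit_density \<pi>0 l m M v vol"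
  have id: "(\<lambda>u. u) \<in> measurable ?T borel"
    unfolding measurable_cong_sets[OF sets_total_volume refl] by (rule measurable_restrict_space1) simp
  have p: "(\<lambda>u. ennreal (?\<phi> u)) \<in> borel_measurable ?T"
    using measurable_compose[OF measurable_compose[OF id \<phi>] measurable_ennreal] .
  have AT: "A \<inter> space ?T \<in> sets ?T" using measurable_sets[OF id A] by simp
  have "emeasure (limit_measure \<pi>0 l m M v vol) A = emeasure (density ?T (\<lambda>u. ennreal (?\<phi> u))) (A \<inter> space ?T)"
    unfolding limit_measure_def 
    by (subst emeasure_distr) (use id A in simp_all)
  also have "\<dots> = (\<integral>\<^sup>+ u. ennreal (?\<phi> u) * indicator (A \<inter> space ?T) u \<partial>?T)"
    by (rule emeasure_density[OF p AT])
  also have "\<dots> = (\<integral>\<^sup>+ u. ennreal (?\<phi> u) * indicator A u \<partial>?T)"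
    by (rule nn_integral_cong) (auto simp: indicator_def)
  also have "\<dots> = (\<Sum>i=1..m. \<integral>\<^sup>+ u. ennreal (?\<phi> u) * indicator A u \<partial>vol i)"
  proof (rule nn_integral_total_volume[OF M vol])
    note [measurable] = \<phi> A
    show "(\<lambda>u. ennreal (?\<phi> u) * indicator A u) \<in> borel_measurable borel" by measurable
  qed
  finally show ?thesis .
qed

section \<open>The Gibbs measures\<close>

lemma nn_integral_UN_disjoint_finite:
  assumes "finite I" "disjoint_family_on N I" "\<And>i. i \<in> I \<Longrightarrow> N i \<in> sets M" "f \<in> borel_measurable M"
  shows "(\<integral>\<^sup>+x\<in>(\<Union>i\<in>I. N i). f x \<partial>M) = (\<Sum>i\<in>I. \<integral>\<^sup>+x\<in>N i. f x \<partial>M)"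
proof -
  have "(\<integral>\<^sup>+x\<in>(\<Union>i\<in>I. N i). f x \<partial>M) = (\<integral>\<^sup>+x. (\<Sum>i\<in>I. f x * indicator (N i) x) \<partial>M)"
    by (simp add: indicator_UN_disjoint[OF assms(1,2)] sum_distrib_left)
  then show ?thesis using assms(3,4) by (simp add: nn_integral_sum)
qed

lemma nn_integral_prior:
  assumes [measurable]: "\<pi>0 \<in> borel_measurable borel" "g \<in> borel_measurable borel" and "\<And>x. \<pi>0 x > 0"
  shows "(\<integral>\<^sup>+x. ennreal (g x) \<partial>prior \<pi>0) = (\<integral>\<^sup>+x. ennreal (g x * \<pi>0 x) \<partial>lborel)"
  unfolding prior_def using assms(3)
  by (subst nn_integral_density) (auto intro!: nn_integral_cong simp: ennreal_mult' less_imp_le mult.commute)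

text \<open>The weight in condition (I) is at least 1 off the unit ball around \<open>y0\<close>;
  the ball itself has finite prior mass, the density being bounded on it.\<close>

lemma nn_integral_exp_neg_finite:
  fixes \<pi>0 l :: "real^'d \<Rightarrow> real"
  assumes c: "continuous_on UNIV \<pi>0" and [measurable]: "l \<in> borel_measurable borel" and l: "\<And>x. l x \<ge> 0" and pos: "\<And>x. \<pi>0 x > 0"
    and I: "(\<integral>\<^sup>+ x. ennreal (norm (x - y0) ^ p * exp (- l x)) \<partial>prior \<pi>0) < \<infinity>"
  shows "(\<integral>\<^sup>+ x. ennreal (exp (- l x)) \<partial>prior \<pi>0) < \<infinity>"
proof -
  have [measurable]: "\<pi>0 \<in> borel_measurable borel" using c by (rule borel_measurable_continuous_onI)
  have [measurable]: "cball y0 1 \<in> sets borel" by simp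
  have "compact (cball y0 1)" by simp
  from compact_uniform_bound[OF this continuous_on_subset[OF c]] obtain B where
    B: "B > 0" "\<And>x. x \<in> cball y0 1 \<Longrightarrow> \<bar>\<pi>0 x\<bar> \<le> B" by auto
  have "(\<integral>\<^sup>+ x. ennreal (exp (- l x)) \<partial>prior \<pi>0) \<le>
      (\<integral>\<^sup>+ x. indicator (cball y0 1) x + ennreal (norm (x - y0) ^ p * exp (- l x)) \<partial>prior \<pi>0)"
  proof (rule nn_integral_mono)
    fix x
    show "ennreal (exp (- l x)) \<le> indicator (cball y0 1) x + ennreal (norm (x - y0) ^ p * exp (- l x))"
    proof (cases "x \<in> cball y0 1")
      case True
      have "ennreal (exp (- l x)) \<le> 1 + 0" using l[of x] by (simp add: ennreal_leI)
      also have "\<dots> \<le> indicator (cball y0 1) x + ennreal (norm (x - y0) ^ p * exp (- l x))"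
        using True by (intro add_mono) auto
      finally show ?thesis .
    next
      case False
      then have "1 \<le> norm (x - y0) ^ p" by (intro one_le_power) (simp add: dist_norm norm_minus_commute)
      then have "1 * exp (- l x) \<le> norm (x - y0) ^ p * exp (- l x)" by (intro mult_right_mono) auto
      then show ?thesis using False by (simp add: ennreal_leI)
    qed
  qed
  also have "\<dots> = emeasure (prior \<pi>0) (cball y0 1) + (\<integral>\<^sup>+ x. ennreal (norm (x - y0) ^ p * exp (- l x)) \<partial>prior \<pi>0)"
    by (subst nn_integral_add) (auto simp: prior_def)
  also have "\<dots> < \<infinity>"
  proof -
    have "emeasure (prior \<pi>0) (cball y0 1) = (\<integral>\<^sup>+x\<in>cball y0 1. ennreal (\<pi>0 x) \<partial>lborel)"
      unfolding prior_def by (rule emeasure_density) auto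
    also have "\<dots> \<le> (\<integral>\<^sup>+x. ennreal B * indicator (cball y0 1) x \<partial>lborel)"
      using B(2) by (intro nn_integral_mono) (force simp: indicator_def intro!: ennreal_leI)
    also have "\<dots> = ennreal B * emeasure lborel (cball y0 1)" by (simp add: nn_integral_cmult_indicator)
    also have "\<dots> < \<infinity>" using emeasure_bounded_finite[OF bounded_cball, of y0 1] by (simp add: ennreal_mult_less_top)
    finally show ?thesis using I by simp
  qed
  finally show ?thesis .
qed

text \<open>Serves the cost outside the tubes, where \<open>norm (x - y0) + D\<close> bounds the
  distance to any point of the zero set. A sum is at most twice the maximum, hence the factor
  \<open>2 ^ p\<close>.\<close>

lemma nn_integral_shifted_moment_finite:
  fixes \<pi>0 l :: "real^'d \<Rightarrow> real"
  assumes [measurable]: "\<pi>0 \<in> borel_measurable borel" "l \<in> borel_measurable borel" and "D \<ge> 0"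
    and I: "(\<integral>\<^sup>+ x. ennreal (norm (x - y0) ^ p * exp (- l x)) \<partial>prior \<pi>0) < \<infinity>"
    and I0: "(\<integral>\<^sup>+ x. ennreal (exp (- l x)) \<partial>prior \<pi>0) < \<infinity>"
  shows "(\<integral>\<^sup>+ x. ennreal ((norm (x - y0) + D) ^ p * exp (- l x)) \<partial>prior \<pi>0) < \<infinity>"
proof -
  have "(\<integral>\<^sup>+ x. ennreal ((norm (x - y0) + D) ^ p * exp (- l x)) \<partial>prior \<pi>0) \<le>
      (\<integral>\<^sup>+ x. ennreal (2 ^ p) * ennreal (norm (x - y0) ^ p * exp (- l x)) + ennreal (2 ^ p * D ^ p) * ennreal (exp (- l x)) \<partial>prior \<pi>0)"
  proof (rule nn_integral_mono)
    fix x
    let ?a = "norm (x - y0)"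
    have "(?a + D) ^ p \<le> (2 * max ?a D) ^ p" using assms(3) by (intro power_mono) auto
    also have "\<dots> \<le> 2 ^ p * (?a ^ p + D ^ p)"
      using assms(3) by (auto simp: max_def power_mult_distrib intro!: mult_left_mono)
    finally have "(?a + D) ^ p * exp (- l x) \<le> 2 ^ p * (?a ^ p + D ^ p) * exp (- l x)"
      by (rule mult_right_mono) simp
    then have "ennreal ((?a + D) ^ p * exp (- l x)) \<le> ennreal (2 ^ p * (?a ^ p * exp (- l x)) + 2 ^ p * D ^ p * exp (- l x))"
      by (intro ennreal_leI) (simp add: algebra_simps)
    also have "\<dots> = ennreal (2 ^ p) * ennreal (?a ^ p * exp (- l x)) + ennreal (2 ^ p * D ^ p) * ennreal (exp (- l x))"
      using assms(3) by (simp add: ennreal_mult)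
    finally show "ennreal ((?a + D) ^ p * exp (- l x)) \<le> \<dots>" .
  qed
  also have "\<dots> = ennreal (2 ^ p) * (\<integral>\<^sup>+ x. ennreal (norm (x - y0) ^ p * exp (- l x)) \<partial>prior \<pi>0) +
      ennreal (2 ^ p * D ^ p) * (\<integral>\<^sup>+ x. ennreal (exp (- l x)) \<partial>prior \<pi>0)"
    by (simp add: nn_integral_add nn_integral_cmult prior_def)
  also have "\<dots> < \<infinity>" using I I0 by (simp add: ennreal_mult_less_top)
  finally show ?thesis .
qed

text \<open>Domination by the case \<open>n = 1\<close> gives integrability, so the Bochner integral
  in \<open>normalization\<close> is not the default value 0.\<close>

lemma ennreal_normalization:
  fixes \<pi>0 l :: "real^'d \<Rightarrow> real"
  assumes [measurable]: "\<pi>0 \<in> borel_measurable borel" "l \<in> borel_measurable borel"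
    and l: "\<And>x. l x \<ge> 0" and pos: "\<And>x. \<pi>0 x > 0" and "n \<ge> 1"
    and I0: "(\<integral>\<^sup>+ x. ennreal (exp (- l x)) \<partial>prior \<pi>0) < \<infinity>"
  shows "ennreal (normalization \<pi>0 l n) = (\<integral>\<^sup>+ x. ennreal (exp (- (real n * l x)) * \<pi>0 x) \<partial>lborel)"
proof -
  let ?g = "\<lambda>x. exp (- real n * l x)"
  have "(\<integral>\<^sup>+ x. ennreal (?g x) \<partial>prior \<pi>0) \<le> (\<integral>\<^sup>+ x. ennreal (exp (- l x)) \<partial>prior \<pi>0)"
  proof (intro nn_integral_mono ennreal_leI)
    fix x show "?g x \<le> exp (- l x)" using mult_right_mono[of 1 "real n" "l x"] l[of x] \<open>n \<ge> 1\<close> by simp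
  qed
  then have "integrable (prior \<pi>0) ?g"
    using I0 by (intro integrableI_nonneg) (auto simp: prior_def)
  then have "(\<integral>\<^sup>+ x. ennreal (?g x) \<partial>prior \<pi>0) = ennreal (normalization \<pi>0 l n)"
    unfolding normalization_def by (intro nn_integral_eq_integral) auto
  then show ?thesis using pos by (simp add: nn_integral_prior)
qed

lemma gibbs_eq_density:
  fixes \<pi>0 l :: "real^'d \<Rightarrow> real"
  assumes [measurable]: "\<pi>0 \<in> borel_measurable borel" "l \<in> borel_measurable borel"
    and pos: "\<And>x. \<pi>0 x > 0" and Z: "normalization \<pi>0 l n > 0"
  shows "gibbs \<pi>0 l n = density lborel (\<lambda>x. ennreal (exp (- (real n * l x)) * \<pi>0 x / normalization \<pi>0 l n))"
  unfolding gibbs_def prior_def using pos Z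
  by (subst density_density_eq) (auto intro!: density_cong simp: ennreal_mult'[symmetric] less_imp_le mult.commute)

theorem theorem3p8:
  fixes p m :: nat
    and \<pi>0 l :: "real^'d \<Rightarrow> real"
    and M :: "nat \<Rightarrow> (real^'d) set"
    and v :: "nat \<Rightarrow> 'c::finite \<Rightarrow> real^'d \<Rightarrow> real^'d"
    and vol :: "nat \<Rightarrow> (real^'d) measure"
    and G :: "nat \<Rightarrow> 'c \<Rightarrow> 'k::finite \<Rightarrow> 'k \<Rightarrow> real^'d \<Rightarrow> real"
    and \<epsilon> :: real
    and F :: "(real^'d) set"
  assumes p: "p \<ge> 1"
    and dims: "CARD('k) + CARD('c) = CARD('d)"
    and pi0: "smooth_on_open \<pi>0 UNIV" "\<And>x. \<pi>0 x > 0"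
    and l: "l \<in> borel_measurable borel" "\<And>x. l x \<ge> 0"
    and cond_M: "m \<ge> 1"
      "\<And>i. i \<in> {1..m} \<Longrightarrow> admissible TYPE('k) (M i) (v i)"
      "disjoint_family_on M {1..m}"
      "zero_set l = (\<Union>i\<in>{1..m}. M i)"
    and vol: "\<And>i. i \<in> {1..m} \<Longrightarrow> riemannian_volume TYPE('k) (M i) (vol i)"
    and radius: "\<And>i. i \<in> {1..m} \<Longrightarrow> tubular_radius (M i) \<epsilon>"
    and weyl: "\<And>i. i \<in> {1..m} \<Longrightarrow> weyl_coefficients (M i) (v i) (vol i) \<epsilon> (G i)"
    and cond_I: "\<exists>y0\<in>zero_set l.
      (\<integral>\<^sup>+ x. ennreal (norm (x - y0) ^ p * exp (- l x)) \<partial>prior \<pi>0) < \<infinity>"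
    and cond_T: "\<epsilon> > 0"
      "disjoint_family_on (\<lambda>i. tubular_nbhd (M i) \<epsilon>) {1..m}"
      "\<And>\<delta>. \<delta> \<in> {0<..\<epsilon>} \<Longrightarrow> (INF x\<in>UNIV - (\<Union>i\<in>{1..m}. tubular_nbhd (M i) \<delta>). l x) > 0"
    and cond_S: "Ck_on (2 * p + 2) l (interior F)"
      "\<And>i. i \<in> {1..m} \<Longrightarrow> tubular_nbhd (M i) \<epsilon> \<subseteq> interior F"
    and cond_P: "\<And>i u. i \<in> {1..m} \<Longrightarrow> u \<in> M i \<Longrightarrow>
      pos_definite (hessian (\<lambda>t. l (tube_map (v i) t u)) 0)"
    and domination: "\<And>n u. n \<ge> 1 \<Longrightarrow> u \<in> zero_set l \<Longrightarrow>
      limit_density \<pi>0 l m M v vol u -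
        (\<Sum>i=1..m. inverse (normalization \<pi>0 l n) * zeta \<pi>0 l (v i) (G i) \<epsilon> n u * indicator (M i) u) \<ge> 0"
  shows "\<exists>K::real. K > 0 \<and>
    (\<forall>n\<ge>1. wasserstein p (gibbs \<pi>0 l n) (limit_measure \<pi>0 l m M v vol)
        \<le> ennreal (K * real n powr (-1/2)))"
proof -

  \<comment> \<open>The manifolds as instances of the tube locales\<close>
  define N where "N i = tubular_nbhd (M i) \<epsilon>" for i
  define I where "I = {1..m}"
  have finI: "finite I" by (simp add: I_def)
  have cont_\<pi>0: "continuous_on UNIV \<pi>0"
    using pi0(1) by (auto simp: smooth_on_open_def dest: spec[of _ "0::nat"])
  have [measurable]: "\<pi>0 \<in> borel_measurable borel" "l \<in> borel_measurable borel"
    using cont_\<pi>0 l(1) by (auto intro: borel_measurable_continuous_onI)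
  have compM: "compact (M i)" if "i \<in> I" for i using cond_M(2) that by (auto simp: I_def admissible_def)
  have svol: "sets (vol i) = sets (restrict_space borel (M i))" if "i \<in> I" for i
    using vol that by (auto simp: I_def riemannian_volume_def)
  have zs: "zero_set l = (\<Union>i\<in>I. M i)" using cond_M(4) by (simp add: I_def)
  have compZ: "compact (zero_set l)" unfolding zs using finI compM by (intro compact_UN) auto
  have tube_mono: "tubular_nbhd (M i) \<delta> \<subseteq> N i" if "\<delta> \<le> \<epsilon>" for i \<delta>
    using that by (auto simp: N_def tubular_nbhd_def normal_bundle_ball_def)
  have disjN: "disjoint_family_on N I" using cond_T(2) by (simp add: N_def[abs_def] I_def)
  have away: "\<exists>c>0. \<forall>x. x \<notin> (\<Union>i\<in>I. tubular_nbhd (M i) \<delta>) \<longrightarrow> l x \<ge> c" if "0 < \<delta>" "\<delta> \<le> \<epsilon>" for \<delta>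
  proof (intro exI conjI allI impI)
    show "(INF x\<in>UNIV - (\<Union>i\<in>I. tubular_nbhd (M i) \<delta>). l x) > 0" using cond_T(3)[of \<delta>] that by (simp add: I_def)
    show "(INF x\<in>UNIV - (\<Union>i\<in>I. tubular_nbhd (M i) \<delta>). l x) \<le> l x" if "x \<notin> (\<Union>i\<in>I. tubular_nbhd (M i) \<delta>)" for x
      using that l(2) by (intro cINF_lower bdd_belowI2[of _ 0]) auto
  qed
  have gt: "gibbs_tube (M i) (v i) (vol i) \<epsilon> (G i) \<pi>0 l (interior F)" if i: "i \<in> I" for i
  proof (unfold_locales)
    show "normal_frame (M i) (v i)" using cond_M(2) i by (auto simp: I_def admissible_def)
    show "Ck_on 2 l (interior F)" using cond_S(1) by (rule Ck_on_mono) simp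
    show "l u = 0" if "u \<in> M i" for u
    proof -
      have "u \<in> zero_set l" unfolding zs using i that by auto
      then show ?thesis by (simp add: zero_set_def)
    qed
    \<comment> \<open>The large tubes are disjoint, so a point of the i-th one that avoids its own
      smaller tube avoids all smaller tubes.\<close>
    show "\<exists>c>0. \<forall>x\<in>tubular_nbhd (M i) \<epsilon> - tubular_nbhd (M i) \<delta>. l x \<ge> c" if \<delta>: "0 < \<delta>" "\<delta> \<le> \<epsilon>" for \<delta>
    proof -
      have "x \<notin> (\<Union>j\<in>I. tubular_nbhd (M j) \<delta>)" if "x \<in> tubular_nbhd (M i) \<epsilon> - tubular_nbhd (M i) \<delta>" for x
        using that disjN i tube_mono[OF \<delta>(2)] by (fastforce simp: disjoint_family_on_def N_def)
      then show ?thesis using away[OF \<delta>] by blast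
    qed
  qed (use i l cont_\<pi>0 pi0 compM svol radius weyl cond_S cond_P in \<open>auto simp: I_def\<close>)
  have tb: "tube (M i) (v i) (vol i) \<epsilon> (G i)" if "i \<in> I" for i
    using gt[OF that] by (simp add: gibbs_tube_def)
  have openN: "open (N i)" if "i \<in> I" for i using tube.open_nbhd[OF tb[OF that]] by (simp add: N_def)
  have spV: "space (vol i) = M i" if "i \<in> I" for i using tube.space_\<nu>[OF tb[OF that]] .

  obtain y0 where y0: "y0 \<in> zero_set l"
    and mom: "(\<integral>\<^sup>+ x. ennreal (norm (x - y0) ^ p * exp (- l x)) \<partial>prior \<pi>0) < \<infinity>"
    using cond_I by blast
  \<comment> \<open>One nonempty manifold suffices for the positivity of the denominator of
    \<open>\<phi>\<close> and for the lower bound on the normalization.\<close>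
  obtain i0 where i0: "i0 \<in> I" "M i0 \<noteq> {}" using y0 by (auto simp: zs)
  have mom0: "(\<integral>\<^sup>+ x. ennreal (exp (- l x)) \<partial>prior \<pi>0) < \<infinity>"
    by (rule nn_integral_exp_neg_finite[OF cont_\<pi>0 l(1,2) pi0(2) mom])
  obtain D where D: "D > 0" "\<And>y. y \<in> zero_set l \<Longrightarrow> norm (y - y0) \<le> D"
  proof -
    have "continuous_on (zero_set l) (\<lambda>y. norm (y - y0))" by (intro continuous_intros)
    from compact_uniform_bound[OF compZ this] show ?thesis using that by auto
  qed

  \<comment> \<open>The limit measure: density, total mass and support\<close>
  define w where "w i = laplace_weight \<pi>0 l (v i)" for i
  define Den where "Den = (\<Sum>i\<in>I. LINT u|vol i. w i u)"
  define \<phi> where "\<phi> = limit_density \<pi>0 l m M v vol"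
  have Den: "Den > 0"
  proof -
    have "(LINT u|vol i0. w i0 u) \<le> Den" unfolding Den_def w_def
      using i0 finI gibbs_tube.integral_laplace_weight_nonneg[OF gt] by (intro member_le_sum) auto
    then show ?thesis using gibbs_tube.integral_laplace_weight_pos[OF gt i0(2)] i0(1) by (simp add: w_def)
  qed
  have \<phi>_eq: "\<phi> u = (\<Sum>i\<in>I. w i u * indicator (M i) u) / Den" for u
    by (simp add: \<phi>_def limit_density_def w_def Den_def I_def)
  have single: "(\<Sum>j\<in>I. f j * indicator (M j) u) = f i" if "i \<in> I" "u \<in> M i" for i u and f :: "nat \<Rightarrow> real"
  proof -
    have "(\<Sum>j\<in>I. f j * indicator (M j) u) = (\<Sum>j\<in>I. if j = i then f j else 0)"
    proof (rule sum.cong[OF refl])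
      fix j assume "j \<in> I"
      then have "u \<notin> M j" if "j \<noteq> i"
        using disjoint_family_onD[OF cond_M(3), of i j] \<open>i \<in> I\<close> \<open>u \<in> M i\<close> that by (auto simp: I_def)
      then show "f j * indicator (M j) u = (if j = i then f j else 0)"
        using \<open>u \<in> M i\<close> by simp
    qed
    then show ?thesis using that finI by simp
  qed
  have \<phi>M: "\<phi> u = w i u / Den" if "i \<in> I" "u \<in> M i" for i u
    by (simp add: \<phi>_eq single[OF that])
  have \<phi>_meas[measurable]: "\<phi> \<in> borel_measurable borel"
  proof -
    have "(\<lambda>u. w i u * indicator (M i) u) \<in> borel_measurable borel" if "i \<in> I" for i
      using borel_measurable_continuous_on_indicator[OF _ gibbs_tube.continuous_on_laplace_weight[OF gt[OF that]]]
        compact_imp_closed[OF compM[OF that]]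
      by (simp add: w_def borel_closed mult.commute)
    then show ?thesis unfolding \<phi>_eq[abs_def] by measurable
  qed
  define \<mu> where "\<mu> = limit_measure \<pi>0 l m M v vol"
  have em\<mu>: "emeasure \<mu> A = (\<Sum>i\<in>I. \<integral>\<^sup>+ u. ennreal (\<phi> u) * indicator A u \<partial>vol i)" if "A \<in> sets borel" for A
    unfolding \<mu>_def \<phi>_def I_def
    by (rule emeasure_limit_measure) (use compM zs svol \<phi>_meas that in \<open>auto simp: I_def \<phi>_def\<close>)
  have s\<mu>: "sets \<mu> = sets borel" by (simp add: \<mu>_def limit_measure_def)
  have prob\<mu>: "prob_space \<mu>"
  proof
    have "emeasure \<mu> UNIV = (\<Sum>i\<in>I. ennreal ((LINT u|vol i. w i u) / Den))"
    proof (subst em\<mu>, simp, rule sum.cong[OF refl])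
      fix i assume i: "i \<in> I"
      have "(\<integral>\<^sup>+ u. ennreal (\<phi> u) * indicator UNIV u \<partial>vol i) = (\<integral>\<^sup>+ u. ennreal (w i u / Den) \<partial>vol i)"
        by (rule nn_integral_cong) (simp add: spV[OF i] \<phi>M[OF i])
      also have "\<dots> = ennreal (LINT u|vol i. w i u / Den)"
        using gibbs_tube.laplace_weight_integrable[OF gt[OF i]] gibbs_tube.laplace_weight_pos[OF gt[OF i]] Den
        by (intro nn_integral_eq_integral AE_I2) (auto simp: w_def spV[OF i] less_imp_le)
      finally show "(\<integral>\<^sup>+ u. ennreal (\<phi> u) * indicator UNIV u \<partial>vol i) = ennreal ((LINT u|vol i. w i u) / Den)" by simp
    qed
    also have "\<dots> = ennreal (\<Sum>i\<in>I. (LINT u|vol i. w i u) / Den)"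
      using gibbs_tube.integral_laplace_weight_nonneg[OF gt] Den by (intro sum_ennreal) (auto simp: w_def)
    also have "\<dots> = 1" using Den by (simp add: sum_divide_distrib[symmetric] Den_def[symmetric])
    finally show "emeasure \<mu> (space \<mu>) = 1" using sets_eq_imp_space_eq[OF s\<mu>] by simp
  qed
  have null: "emeasure \<mu> (- zero_set l) = 0"
  proof -
    have "(\<integral>\<^sup>+ u. ennreal (\<phi> u) * indicator (- zero_set l) u \<partial>vol i) = (\<integral>\<^sup>+ u. 0 \<partial>vol i)" if i: "i \<in> I" for i
      using i by (intro nn_integral_cong) (auto simp: spV zs indicator_def)
    then show ?thesis using compact_imp_closed[OF compZ] by (subst em\<mu>) (auto intro: borel_closed)
  qed

  \<comment> \<open>The transport map glued from the foot point projections\<close>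
  define P where "P x = (\<Sum>i\<in>I. indicator (N i) x *\<^sub>R tube.foot (M i) \<epsilon> x)" for x
  have P_meas[measurable]: "P \<in> borel_measurable borel"
    unfolding P_def[abs_def]
  proof (rule borel_measurable_sum)
    fix i assume i: "i \<in> I"
    show "(\<lambda>x. indicator (N i) x *\<^sub>R tube.foot (M i) \<epsilon> x) \<in> borel_measurable borel"
      using borel_measurable_continuous_on_indicator[OF _ tube.continuous_on_foot[OF tb[OF i]]] openN[OF i]
      by (simp add: N_def)
  qed
  have P_foot: "P x = tube.foot (M i) \<epsilon> x" if "i \<in> I" "x \<in> tubular_nbhd (M i) \<epsilon>" for i x
  proof -
    have "P x = (\<Sum>j\<in>I. if j = i then tube.foot (M j) \<epsilon> x else 0)"
      unfolding P_def
    proof (rule sum.cong[OF refl])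
      fix j assume "j \<in> I"
      then have "x \<notin> N j" if "j \<noteq> i"
        using disjoint_family_onD[OF disjN, of i j] \<open>i \<in> I\<close> \<open>x \<in> tubular_nbhd (M i) \<epsilon>\<close> that by (auto simp: N_def)
      then show "indicator (N j) x *\<^sub>R tube.foot (M j) \<epsilon> x = (if j = i then tube.foot (M j) \<epsilon> x else 0)"
        using \<open>x \<in> tubular_nbhd (M i) \<epsilon>\<close> by (simp add: N_def)
    qed
    then show ?thesis using that finI by simp
  qed
  define NN where "NN = (\<Union>i\<in>I. N i)"
  have NN_meas[measurable]: "NN \<in> sets borel" unfolding NN_def using openN by (intro borel_open open_UN) auto
  have split: "(\<integral>\<^sup>+x\<in>NN. f x \<partial>lborel) = (\<Sum>i\<in>I. \<integral>\<^sup>+x\<in>tubular_nbhd (M i) \<epsilon>. f x \<partial>lborel)"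
    if "f \<in> borel_measurable borel" for f
    unfolding NN_def N_def[symmetric] by (rule nn_integral_UN_disjoint_finite) (use finI disjN openN that in auto)

  \<comment> \<open>Constants independent of n\<close>
  define C where "C = CARD('c)"
  have "\<forall>i\<in>I. \<exists>K. K \<ge> 0 \<and> (\<forall>n\<ge>1. (\<integral>\<^sup>+ x\<in>tubular_nbhd (M i) \<epsilon>. ennreal (norm (x - P x) ^ p * (exp (- (real n * l x)) * \<pi>0 x)) \<partial>lborel)
      \<le> ennreal (K * (1 / sqrt (real n)) ^ (p + C)))"
    using gibbs_tube.nn_integral_transport[OF gt P_meas P_foot] unfolding C_def by blast
  from bchoice[OF this] obtain Kf where Kf: "\<And>i. i \<in> I \<Longrightarrow> Kf i \<ge> 0"
    "\<And>i n. i \<in> I \<Longrightarrow> n \<ge> 1 \<Longrightarrow> (\<integral>\<^sup>+ x\<in>tubular_nbhd (M i) \<epsilon>. ennreal (norm (x - P x) ^ p * (exp (- (real n * l x)) * \<pi>0 x)) \<partial>lborel)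
      \<le> ennreal (Kf i * (1 / sqrt (real n)) ^ (p + C))"
    by blast
  obtain a where a: "a > 0" "\<And>n. n \<ge> 1 \<Longrightarrow> ennreal (a * (1 / sqrt (real n)) ^ C) \<le>
      (\<integral>\<^sup>+ x\<in>tubular_nbhd (M i0) \<epsilon>. ennreal (exp (- (real n * l x)) * \<pi>0 x) \<partial>lborel)"
    using gibbs_tube.nn_integral_gibbs_lower[OF gt[OF i0(1)] i0(2)] unfolding C_def by blast
  obtain c where c: "c > 0" "\<And>x. x \<notin> NN \<Longrightarrow> l x \<ge> c"
    using away[OF cond_T(1)] by (auto simp: NN_def N_def)
  \<comment> \<open>The moment of condition (I), with the distance to \<open>y0\<close> enlarged by
    the radius \<open>D\<close> of a ball around \<open>y0\<close> that contains the zero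
    set.\<close>
  define J where "J = enn2real (\<integral>\<^sup>+ x. ennreal ((norm (x - y0) + D) ^ p * exp (- l x)) \<partial>prior \<pi>0)"
  have J: "J \<ge> 0" "(\<integral>\<^sup>+ x. ennreal ((norm (x - y0) + D) ^ p * exp (- l x) * \<pi>0 x) \<partial>lborel) = ennreal J"
  proof -
    show "J \<ge> 0" by (simp add: J_def)
    have "(\<integral>\<^sup>+ x. ennreal ((norm (x - y0) + D) ^ p * exp (- l x)) \<partial>prior \<pi>0) = ennreal J"
      using nn_integral_shifted_moment_finite[OF _ _ _ mom mom0, of D] D(1) by (simp add: J_def)
    then show "(\<integral>\<^sup>+ x. ennreal ((norm (x - y0) + D) ^ p * exp (- l x) * \<pi>0 x) \<partial>lborel) = ennreal J"
      using pi0(2) by (subst (asm) nn_integral_prior) auto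
  qed

  define B where "B = fact (p + C) / c ^ (p + C)"
  have B: "B > 0" using c by (simp add: B_def)
  \<comment> \<open>The numerator adds the cost inside the tubes and the cost outside, where
    \<open>B\<close> turns exponential decay into a power of \<open>n\<close>; \<open>a\<close> is
    the constant of the lower bound on the normalization.\<close>
  define L where "L = ((\<Sum>i\<in>I. Kf i) + exp c * B * J) / a"
  have L: "L \<ge> 0" unfolding L_def using Kf(1) B J(1) a by (intro divide_nonneg_pos add_nonneg_nonneg sum_nonneg) auto

  \<comment> \<open>The estimate for a fixed n\<close>
  have main: "wasserstein p (gibbs \<pi>0 l n) \<mu> \<le> ennreal ((1 + L) * real n powr (-1/2))" if n: "n \<ge> 1" for n
  proof -
    define R where "R = 1 / sqrt (real n)"
    have R: "R > 0" "R \<le> 1" "R\<^sup>2 = 1 / real n" using n by (auto simp: R_def power_divide)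
    define Z where "Z = normalization \<pi>0 l n"
    have Zeq: "ennreal Z = (\<integral>\<^sup>+ x. ennreal (exp (- (real n * l x)) * \<pi>0 x) \<partial>lborel)"
      unfolding Z_def by (rule ennreal_normalization) (use l pi0 n mom0 in auto)
    \<comment> \<open>The tube around \<open>M i0\<close> alone carries this much mass.\<close>
    have "ennreal (a * R ^ C) \<le> ennreal Z"
      unfolding Zeq R_def by (rule order_trans[OF a(2)[OF n]]) (auto intro!: nn_integral_mono simp: indicator_def)
    moreover have aR: "a * R ^ C > 0" using a(1) R(1) by simp
    ultimately have Zlow: "a * R ^ C \<le> Z" by (auto simp: ennreal_le_iff2)
    have Z: "Z > 0" using Zlow aR by linarith
    define g where "g x = exp (- (real n * l x)) * \<pi>0 x" for x
    have [measurable]: "g \<in> borel_measurable borel" unfolding g_def[abs_def] by measurable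
    have g0: "g x \<ge> 0" for x using pi0(2)[of x] by (simp add: g_def)
    have gibbs: "gibbs \<pi>0 l n = density lborel (\<lambda>x. ennreal (g x / Z))"
      unfolding Z_def g_def by (rule gibbs_eq_density) (use pi0 Z in \<open>auto simp: Z_def\<close>)
    have int: "(\<integral>\<^sup>+x. f x \<partial>gibbs \<pi>0 l n) = (\<integral>\<^sup>+x. ennreal (g x / Z) * f x \<partial>lborel)"
      if "f \<in> borel_measurable borel" for f
      unfolding gibbs using that by (subst nn_integral_density) auto
    have sg: "sets (gibbs \<pi>0 l n) = sets borel" by (simp add: gibbs)
    have prob: "prob_space (gibbs \<pi>0 l n)"
    proof
      have "emeasure (gibbs \<pi>0 l n) UNIV = (\<integral>\<^sup>+x. ennreal (inverse Z) * ennreal (g x) \<partial>lborel)"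
        unfolding gibbs using Z g0
        by (subst emeasure_density) (auto simp: ennreal_mult[symmetric] divide_inverse mult.commute intro!: nn_integral_cong)
      also have "\<dots> = ennreal (inverse Z) * ennreal Z"
        unfolding Zeq g_def[symmetric] by (rule nn_integral_cmult) auto
      also have "\<dots> = 1" using Z by (simp add: ennreal_mult[symmetric])
      finally show "emeasure (gibbs \<pi>0 l n) (space (gibbs \<pi>0 l n)) = 1"
        by (simp add: sets_eq_imp_space_eq[OF sg])
    qed
    have dom: "emeasure (gibbs \<pi>0 l n) {x \<in> NN. P x \<in> A} \<le> emeasure \<mu> A" if A[measurable]: "A \<in> sets borel" for A
    proof -
      have "emeasure (gibbs \<pi>0 l n) {x \<in> NN. P x \<in> A} = (\<integral>\<^sup>+x\<in>NN. ennreal (g x / Z) * indicator A (P x) \<partial>lborel)"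
        unfolding gibbs by (subst emeasure_density) (auto intro!: nn_integral_cong simp: indicator_def)
      also have "\<dots> = (\<Sum>i\<in>I. \<integral>\<^sup>+x\<in>tubular_nbhd (M i) \<epsilon>. ennreal (g x / Z) * indicator A (P x) \<partial>lborel)"
        by (rule split) measurable
      also have "\<dots> = (\<Sum>i\<in>I. \<integral>\<^sup>+ u. ennreal (inverse Z * zeta \<pi>0 l (v i) (G i) \<epsilon> n u) * indicator A u \<partial>vol i)"
        unfolding g_def
        by (intro sum.cong refl gibbs_tube.marginal_foot[OF gt P_meas P_foot A Z])
      also have "\<dots> \<le> (\<Sum>i\<in>I. \<integral>\<^sup>+ u. ennreal (\<phi> u) * indicator A u \<partial>vol i)"
      proof (intro sum_mono nn_integral_mono mult_right_mono ennreal_leI)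
        fix i u assume i: "i \<in> I" and "u \<in> space (vol i)"
        then have u: "u \<in> M i" by (simp add: spV)
        then have "u \<in> zero_set l" using i by (auto simp: zs)
        \<comment> \<open>At \<open>u\<close> the other manifolds drop out of both sums, so the
          hypothesis compares the two densities pointwise.\<close>
        from domination[OF n this] show "inverse Z * zeta \<pi>0 l (v i) (G i) \<epsilon> n u \<le> \<phi> u"
          using single[OF i u, of "\<lambda>i. inverse Z * zeta \<pi>0 l (v i) (G i) \<epsilon> n u"] by (simp add: \<phi>_def Z_def I_def)
      qed auto
      finally show ?thesis by (simp add: em\<mu>)
    qed
    obtain \<gamma> where \<gamma>: "\<gamma> \<in> couplings (gibbs \<pi>0 l n) \<mu>"
      "(\<integral>\<^sup>+ (x, y). ennreal (norm (x - y) ^ p) \<partial>\<gamma>) \<le>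
        (\<integral>\<^sup>+ x\<in>NN. ennreal (norm (x - P x) ^ p) \<partial>gibbs \<pi>0 l n) +
        (\<integral>\<^sup>+ x\<in>-NN. ennreal ((norm (x - y0) + D) ^ p) \<partial>gibbs \<pi>0 l n)"
      using ex_coupling_projection[OF prob sg prob\<mu> s\<mu> NN_meas P_meas borel_closed[OF compact_imp_closed[OF compZ]] dom null D(2)]
      by (rule bexE)
    have cost1: "(\<integral>\<^sup>+ x\<in>NN. ennreal (norm (x - P x) ^ p) \<partial>gibbs \<pi>0 l n) \<le> ennreal (inverse Z * ((\<Sum>i\<in>I. Kf i) * R ^ (p + C)))"
    proof -
      have "(\<integral>\<^sup>+ x\<in>NN. ennreal (norm (x - P x) ^ p) \<partial>gibbs \<pi>0 l n) =
          (\<integral>\<^sup>+ x. ennreal (inverse Z) * (ennreal (norm (x - P x) ^ p * g x) * indicator NN x) \<partial>lborel)"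
        using Z g0 by (subst int) (auto intro!: nn_integral_cong simp: indicator_def ennreal_mult[symmetric] divide_inverse mult_ac)
      also have "\<dots> = ennreal (inverse Z) * (\<integral>\<^sup>+ x\<in>NN. ennreal (norm (x - P x) ^ p * g x) \<partial>lborel)"
        by (rule nn_integral_cmult) measurable
      also have "(\<integral>\<^sup>+ x\<in>NN. ennreal (norm (x - P x) ^ p * g x) \<partial>lborel) =
          (\<Sum>i\<in>I. \<integral>\<^sup>+ x\<in>tubular_nbhd (M i) \<epsilon>. ennreal (norm (x - P x) ^ p * g x) \<partial>lborel)"
        by (rule split) measurable
      also have "\<dots> \<le> (\<Sum>i\<in>I. ennreal (Kf i * R ^ (p + C)))"
        unfolding g_def R_def by (intro sum_mono Kf(2) n)
      also have "\<dots> = ennreal ((\<Sum>i\<in>I. Kf i) * R ^ (p + C))"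
        using Kf(1) R(1) by (subst sum_ennreal) (auto simp: sum_distrib_right)
      finally show ?thesis using Z by (simp add: ennreal_mult' mult_left_mono)
    qed
    have cost2: "(\<integral>\<^sup>+ x\<in>-NN. ennreal ((norm (x - y0) + D) ^ p) \<partial>gibbs \<pi>0 l n) \<le> ennreal (inverse Z * (exp (c - c * real n) * J))"
    proof -
      have "(\<integral>\<^sup>+ x\<in>-NN. ennreal ((norm (x - y0) + D) ^ p) \<partial>gibbs \<pi>0 l n) =
          (\<integral>\<^sup>+ x\<in>-NN. ennreal (g x / Z * (norm (x - y0) + D) ^ p) \<partial>lborel)"
        using Z g0 D(1) by (subst int) (auto intro!: nn_integral_cong simp: indicator_def ennreal_mult[symmetric])
      also have "\<dots> \<le> (\<integral>\<^sup>+ x. ennreal (inverse Z * exp (c - c * real n)) * ennreal ((norm (x - y0) + D) ^ p * exp (- l x) * \<pi>0 x) \<partial>lborel)"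
      proof (rule nn_integral_mono)
        fix x
        have "ennreal (g x / Z * (norm (x - y0) + D) ^ p) \<le>
          ennreal (inverse Z * exp (c - c * real n)) * ennreal ((norm (x - y0) + D) ^ p * exp (- l x) * \<pi>0 x)" if "x \<notin> NN"
        proof -
          \<comment> \<open>One factor \<open>exp (- l x)\<close> is kept for integrability; the
            other \<open>n - 1\<close> are bounded through \<open>c\<close>, the lower bound of
            \<open>l\<close> off the tubes.\<close>
          have "(real n - 1) * c \<le> (real n - 1) * l x" using c(2)[OF that] n by (intro mult_left_mono) auto
          then have "exp (- (real n * l x)) \<le> exp (c - c * real n) * exp (- l x)"
            by (simp add: exp_add[symmetric] algebra_simps)
          then have "exp (- (real n * l x)) * \<pi>0 x * (inverse Z * (norm (x - y0) + D) ^ p) \<le>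
              exp (c - c * real n) * exp (- l x) * \<pi>0 x * (inverse Z * (norm (x - y0) + D) ^ p)"
            using pi0(2)[of x] Z D(1) by (intro mult_right_mono) auto
          then show ?thesis using Z D(1) pi0(2)[of x]
            by (subst ennreal_mult[symmetric]) (auto intro!: ennreal_leI simp: g_def divide_inverse mult_ac)
        qed
        then show "ennreal (g x / Z * (norm (x - y0) + D) ^ p) * indicator (- NN) x \<le>
          ennreal (inverse Z * exp (c - c * real n)) * ennreal ((norm (x - y0) + D) ^ p * exp (- l x) * \<pi>0 x)"
          by (auto simp: indicator_def)
      qed
      also have "\<dots> = ennreal (inverse Z * exp (c - c * real n)) * ennreal J"
        unfolding J(2)[symmetric] by (rule nn_integral_cmult) measurable
      finally show ?thesis using Z J(1) by (simp add: ennreal_mult[symmetric] mult_ac)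
    qed
    have "exp (c - c * real n) \<le> exp c * B * R ^ (p + C)"
    proof -
      have "real n ^ (p + C) * exp (- (c * real n)) \<le> B"
        unfolding B_def by (rule power_times_exp_le) (use c in auto)
      then have "exp (- (c * real n)) \<le> B * (1 / real n) ^ (p + C)"
        using n by (simp add: field_simps power_divide)
      \<comment> \<open>Here \<open>1 / real n\<close> is the square of \<open>R\<close>, hence at
        most \<open>R\<close>.\<close>
      also have "\<dots> \<le> B * R ^ (p + C)"
        using B R n by (intro mult_left_mono power_mono) (auto simp: R(3)[symmetric] power2_eq_square mult_le_cancel_left1)
      finally show ?thesis by (simp add: exp_diff exp_minus field_simps)
    qed
    then have "inverse Z * ((\<Sum>i\<in>I. Kf i) * R ^ (p + C)) + inverse Z * (exp (c - c * real n) * J) \<le>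
        inverse Z * ((\<Sum>i\<in>I. Kf i) * R ^ (p + C)) + inverse Z * (exp c * B * R ^ (p + C) * J)"
      using Z J(1) by (intro add_left_mono mult_left_mono mult_right_mono) auto
    also have "\<dots> = inverse Z * (a * L * R ^ (p + C))"
    proof -
      have "a * L = (\<Sum>i\<in>I. Kf i) + exp c * B * J" using a(1) by (simp add: L_def)
      then show ?thesis by (simp add: algebra_simps)
    qed
    \<comment> \<open>The lower bound on \<open>Z\<close> cancels \<open>R ^ C\<close> and leaves
      \<open>R ^ p\<close>, whose p-th root is the rate.\<close>
    also have "\<dots> \<le> inverse (a * R ^ C) * (a * L * R ^ (p + C))"
      using Zlow aR a(1) L R(1) by (intro mult_right_mono le_imp_inverse_le) auto
    also have "\<dots> = L * R ^ p" using a(1) R(1) by (simp add: power_add field_simps)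
    \<comment> \<open>\<open>1 + L\<close> is at least 1, so its p-th power exceeds
      \<open>L\<close>; it also keeps the final constant positive when \<open>L\<close> is
      0.\<close>
    also have "\<dots> \<le> (1 + L) ^ p * R ^ p"
      using self_le_power[of "1 + L" p] L p R(1) by (intro mult_right_mono) auto
    also have "\<dots> = ((1 + L) * R) ^ p" by (simp add: power_mult_distrib)
    finally have le: "inverse Z * ((\<Sum>i\<in>I. Kf i) * R ^ (p + C)) + inverse Z * (exp (c - c * real n) * J) \<le> ((1 + L) * R) ^ p" .
    have "(\<integral>\<^sup>+ (x, y). ennreal (norm (x - y) ^ p) \<partial>\<gamma>) \<le>
        ennreal (inverse Z * ((\<Sum>i\<in>I. Kf i) * R ^ (p + C))) + ennreal (inverse Z * (exp (c - c * real n) * J))"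
      using \<gamma>(2) add_mono[OF cost1 cost2] by (rule order_trans)
    also have "\<dots> = ennreal (inverse Z * ((\<Sum>i\<in>I. Kf i) * R ^ (p + C)) + inverse Z * (exp (c - c * real n) * J))"
      using Z J(1) Kf(1) R(1) by (intro ennreal_plus[symmetric] mult_nonneg_nonneg sum_nonneg) auto
    also have "\<dots> \<le> ennreal (((1 + L) * R) ^ p)" using le by (rule ennreal_leI)
    finally have "(\<integral>\<^sup>+ (x, y). ennreal (norm (x - y) ^ p) \<partial>\<gamma>) \<le> \<dots>" .
    then have "wasserstein p (gibbs \<pi>0 l n) \<mu> \<le> ennreal ((1 + L) * R)"
      using \<gamma>(1) p L R(1) by (intro wasserstein_le_of_coupling) auto
    moreover have "R = real n powr (-1/2)"
      using n by (simp add: R_def powr_half_sqrt powr_minus_divide)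
    ultimately show ?thesis by simp
  qed
  show ?thesis
    using main L by (intro exI[of _ "1 + L"]) (auto simp: \<mu>_def)
qed

end
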